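(* Let $V$ be an infinitesimal generator of the (Lie point) symmetry group of Lamé's system of first order (written out in the context), of the form $$V=\sum_{i=1}^3 \xi^i(x,l,h)\frac{\partial}{\partial x_i}+\sum_{i=1}^3\eta^i(x,l,h)\frac{\partial}{\partial l_i}+\sum_{i,j=1,\ i\neq j}^3\phi^{ij}(x,l,h)\frac{\partial}{\partial h_{ij}}.$$ Then there are real constants $a,c,a_1,a_2,a_3$ such that, for all $i$ and all $j\neq i$, $$\xi^i=a x_i+a_i,\qquad \eta^i=c\,l_i,\qquad \phi^{ij}=-a\,h_{ij}.$$
   Context: Subscripts $,x_i$ denote partial derivatives with respect to $x_i$. Put $\varepsilon_1=\varepsilon_3=1$, $\varepsilon_2=-1$. The independent variables are $x=(x_1,x_2,x_3)$; the dependent variables are $l=(l_1,l_2,l_3)$ (nowhere zero) and $h=(h_{ij})_{i\ne j}$, an off-diagonal $3\times 3$ matrix. Lamé's system of first order consists of the following equations for all distinct $i,j,k\in\{1,2,3\}$: $$\varepsilon_i l_i^2+\varepsilon_j l_j^2+\varepsilon_k l_k^2=0,$$ $$l_{i,x_j}-h_{ij}l_j=0,$$ $$\varepsilon_i l_{i,x_i}+\varepsilon_j h_{ji}l_j+\varepsilon_k h_{ki}l_k=0,$$ $$h_{ij,x_k}-h_{ik}h_{kj}=0,$$ $$h_{ij,x_j}+h_{ji,x_i}+h_{ik}h_{jk}=0,$$ $$\varepsilon_i h_{ij,x_i}+\varepsilon_j h_{ji,x_j}+\varepsilon_k h_{ki}h_{kj}=0.$$ A smooth vector field $V$ on an open set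 of the space of variables $(x,l,h)$ is an infinitesimal generator of the symmetry group if it satisfies the infinitesimal criterion: writing the system as $\Delta_r(x,u^{(1)})=0$ with $u=(l,h)$, one has $\mathrm{pr}^{(1)}V[\Delta_r]=0$ for all $r$ whenever $\Delta_s=0$ for all $s$. Here $\mathrm{pr}^{(1)}V$ is the first prolongation of $V$ to the space of variables $(x,u,u_{,x})$: for $V=\sum_i\xi^i\partial_{x_i}+\sum_\alpha\phi_\alpha\partial_{u^\alpha}$, $$\mathrm{pr}^{(1)}V=V+\sum_{\alpha,k}\Big(D_k\phi_\alpha-\sum_r (D_k\xi^r)\,u^\alpha_{,x_r}\Big)\frac{\partial}{\partial u^\alpha_{,x_k}},$$ with $D_k$ the total derivative with respect to $x_k$. Since the system contains the algebraic relation $l_1^2-l_2^2+l_3^2=0$, the coefficient functions of $V$ are considered (and the stated equalities are understood) at points $(x,l,h)$ satisfying this relation.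
   Formalization: The constants a, c, a_i are asserted separately on each connected component of the part of V's domain satisfying the algebraic relation; with one set of constants for a disconnected domain the claim is false (c may change with the signs of the l_i). *)

theory Defs
  imports "HOL-Analysis.Analysis"
begin

section \<open>Smooth maps\<close>

fun Ck_on :: "nat \<Rightarrow> 'a::real_normed_vector set \<Rightarrow> ('a \<Rightarrow> 'b::real_normed_vector) \<Rightarrow> bool" where
  "Ck_on 0 S f \<longleftrightarrow> continuous_on S f"
| "Ck_on (Suc n) S f \<longleftrightarrow>
     (\<forall>z\<in>S. f differentiable (at z)) \<and> (\<forall>v. Ck_on n S (\<lambda>z. frechet_derivative f (at z) v))"

text \<open>Only meaningful for open \<open>S\<close>.\<close>

definition smooth_on :: "'a::real_normed_vector set \<Rightarrow> ('a \<Rightarrow> 'b::real_normed_vector) \<Rightarrow> bool" where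
  "smooth_on S f \<longleftrightarrow> (\<forall>n. Ck_on n S f)"

section \<open>Point symmetries of first-order systems\<close>

text \<open>
  Independent variables are indexed by \<open>'p\<close>, dependent variables by \<open>'q\<close>. In a jet
  \<open>(x, u, w)\<close> the entry \<open>w $ \<alpha> $ k\<close> stands for the derivative of \<open>u $ \<alpha>\<close> with
  respect to \<open>x $ k\<close>.
\<close>

type_synonym ('p, 'q) pt = "(real ^ 'p) \<times> (real ^ 'q)"
type_synonym ('p, 'q) jet = "(real ^ 'p) \<times> (real ^ 'q) \<times> (real ^ 'p ^ 'q)"

definition total_deriv ::
  "'p \<Rightarrow> (('p::finite, 'q::finite) pt \<Rightarrow> real) \<Rightarrow> ('p, 'q) jet \<Rightarrow> real" where
  "total_deriv k f = (\<lambda>(x, u, w).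
     frechet_derivative f (at (x, u)) (axis k 1, 0)
     + (\<Sum>\<alpha>\<in>UNIV. w $ \<alpha> $ k * frechet_derivative f (at (x, u)) (0, axis \<alpha> 1)))"

text \<open>
  A vector field \<open>V\<close> has the components \<open>\<xi>\<^sup>i = fst (V z) $ i\<close> along \<open>x\<close> and
  \<open>\<phi>\<^sub>\<alpha> = snd (V z) $ \<alpha>\<close> along \<open>u\<close>.
\<close>

definition prolong1 ::
  "(('p::finite, 'q::finite) pt \<Rightarrow> ('p, 'q) pt) \<Rightarrow> ('p, 'q) jet \<Rightarrow> ('p, 'q) jet" where
  "prolong1 V = (\<lambda>(x, u, w).
     (fst (V (x, u)), snd (V (x, u)),
      \<chi> \<alpha> k. total_deriv k (\<lambda>z. snd (V z) $ \<alpha>) (x, u, w)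
        - (\<Sum>r\<in>UNIV. total_deriv k (\<lambda>z. fst (V z) $ r) (x, u, w) * w $ \<alpha> $ r)))"

definition infinitesimal_symmetry ::
  "(('p::finite, 'q::finite) jet \<Rightarrow> real) set \<Rightarrow> ('p, 'q) pt set
    \<Rightarrow> (('p, 'q) pt \<Rightarrow> ('p, 'q) pt) \<Rightarrow> bool" where
  "infinitesimal_symmetry Sys M V \<longleftrightarrow>
     (\<forall>x u w. (x, u) \<in> M \<longrightarrow> (\<forall>\<Delta>\<in>Sys. \<Delta> (x, u, w) = 0) \<longrightarrow>
        (\<forall>\<Delta>\<in>Sys. frechet_derivative \<Delta> (at (x, u, w)) (prolong1 V (x, u, w)) = 0))"

section \<open>Lame's system of first order\<close>

typedef offdiag = "{(i, j). i \<noteq> j} :: (3 \<times> 3) set"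
  by (rule exI[of _ "(0, 1)"]) simp

instance offdiag :: finite
proof
  have "(UNIV :: offdiag set) = Abs_offdiag ` {(i, j). i \<noteq> j}"
    by (metis (no_types, lifting) Rep_offdiag Rep_offdiag_inverse UNIV_eq_I image_eqI)
  then show "finite (UNIV :: offdiag set)" by (metis finite finite_imageI)
qed

text \<open>
  The dependent variables are \<open>u = (l, h)\<close>: index \<open>Inl i\<close> belongs to \<open>l\<^sub>i\<close>, and
  \<open>H i j\<close> to \<open>h\<^sub>i\<^sub>j\<close>. \<open>H i j\<close> is unspecified for \<open>i = j\<close>. In the index type
  \<open>3\<close> the elements are \<open>1\<close>, \<open>2\<close> and \<open>3 = 0\<close>.
\<close>

type_synonym dep = "3 + offdiag"

abbreviation L :: "3 \<Rightarrow> dep" where "L i \<equiv> Inl i"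

definition H :: "3 \<Rightarrow> 3 \<Rightarrow> dep" where "H i j = Inr (Abs_offdiag (i, j))"

definition eps :: "3 \<Rightarrow> real" where "eps i = (if i = 2 then - 1 else 1)"

definition lame_cone :: "(3, dep) pt set" where
  "lame_cone = {(x, u). (u $ L 1)\<^sup>2 - (u $ L 2)\<^sup>2 + (u $ L 3)\<^sup>2 = 0}"

definition lame_equations :: "3 \<Rightarrow> 3 \<Rightarrow> 3 \<Rightarrow> ((3, dep) jet \<Rightarrow> real) set" where
  "lame_equations i j k =
    {\<lambda>(x, u, w). eps i * (u $ L i)\<^sup>2 + eps j * (u $ L j)\<^sup>2 + eps k * (u $ L k)\<^sup>2,
     \<lambda>(x, u, w). w $ L i $ j - u $ H i j * u $ L j,
     \<lambda>(x, u, w). eps i * w $ L i $ i + eps j * u $ H j i * u $ L j + eps k * u $ H k i * u $ L k,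
     \<lambda>(x, u, w). w $ H i j $ k - u $ H i k * u $ H k j,
     \<lambda>(x, u, w). w $ H i j $ j + w $ H j i $ i + u $ H i k * u $ H j k,
     \<lambda>(x, u, w). eps i * w $ H i j $ i + eps j * w $ H j i $ j + eps k * u $ H k i * u $ H k j}"

definition lame_system :: "((3, dep) jet \<Rightarrow> real) set" where
  "lame_system = \<Union> {lame_equations i j k | i j k. i \<noteq> j \<and> j \<noteq> k \<and> i \<noteq> k}"

end

theory Submission
  imports Defs
begin

text \<open>
  The equations determine all first derivatives except six free ones of \<open>h\<close>, and the prolonged
  equations are polynomial in these. Comparing jets over the same point that differ in free
  coordinates shows that \<open>\<xi>\<close> and \<open>\<eta>\<close> do not depend on \<open>h\<close>, that \<open>\<phi>\<^sup>i\<^sup>j\<close> depends at most on the entries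
  \<open>ij\<close> and \<open>ji\<close> of \<open>h\<close>, and that \<open>D\<^sub>k \<xi>\<^sup>i = 0\<close> for \<open>k \<noteq> i\<close>. The remaining equations are then polynomial in
  \<open>h\<close> with coefficients that stay constant when \<open>h\<close> moves, so they split again. They force
  \<open>\<eta>\<^sup>i = c l\<^sub>i\<close> and \<open>\<phi>\<^sup>i\<^sup>j = - p h\<^sub>i\<^sub>j\<close> with \<open>p = \<partial>\<xi>\<^sup>i/\<partial>x\<^sub>i\<close> the same for all \<open>i\<close>. As \<open>\<xi>\<^sup>i\<close> depends locally on
  \<open>x\<^sub>i\<close> only, \<open>p\<close> is locally constant. All derivatives are taken along the cone, and finite
  differences in \<open>h\<close> replace second derivatives throughout.
\<close>

section \<open>Jets solving the system\<close>

lemma sum_3_distinct: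
  fixes f :: "3 \<Rightarrow> 'a::comm_monoid_add"
  assumes "i \<noteq> j" "j \<noteq> k" "i \<noteq> k"
  shows "(\<Sum>r\<in>UNIV. f r) = f i + f j + f k"
proof -
  have "r = i \<or> r = j \<or> r = k" for r
    using assms exhaust_3[of r] exhaust_3[of i] exhaust_3[of j] exhaust_3[of k] by metis
  then have U: "UNIV = {i, j, k}" by auto
  show ?thesis unfolding U using assms by (simp add: add.assoc)
qed

lemma cases_3_distinct:
  fixes i j k m :: 3
  assumes "i \<noteq> j" "j \<noteq> k" "i \<noteq> k"
  obtains "m = i" | "m = j" | "m = k"
  using assms exhaust_3[of m] exhaust_3[of i] exhaust_3[of j] exhaust_3[of k] by metis

lemma third_index:
  fixes i j :: 3
  obtains k where "k \<noteq> i" "k \<noteq> j"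
proof -
  have "(1::3) \<noteq> 2" "(1::3) \<noteq> 3" "(2::3) \<noteq> 3" by simp_all
  then show ?thesis using that by metis
qed

lemma H_eq_iff: "i \<noteq> j \<Longrightarrow> m \<noteq> n \<Longrightarrow> H i j = H m n \<longleftrightarrow> i = m \<and> j = n"
  by (simp add: H_def Abs_offdiag_inject)

lemma H_neq_L [simp]: "H i j \<noteq> L m" "L m \<noteq> H i j"
  by (simp_all add: H_def)

lemma dep_cases:
  fixes \<alpha> :: dep
  obtains m where "\<alpha> = L m" | m n where "m \<noteq> n" "\<alpha> = H m n"
proof (cases \<alpha>)
  case (Inr p)
  obtain m n where "Rep_offdiag p = (m, n)" by force
  then show ?thesis using Inr that(2)[of m n] Rep_offdiag[of p] Rep_offdiag_inverse[of p]
    by (auto simp: H_def)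
qed (use that in auto)

lemma eps_sq [simp]: "eps i * eps i = 1" "eps i * (eps i * x) = x"
  by (simp_all add: eps_def)

lemma eps_neq_0 [simp]: "eps i \<noteq> 0"
  by (simp add: eps_def)

section \<open>Coordinate and tangent vectors\<close>

definition xv :: "3 \<Rightarrow> (3, dep) pt" where "xv k = (axis k 1, 0)"
definition lv :: "3 \<Rightarrow> (3, dep) pt" where "lv i = (0, axis (L i) 1)"
definition hv :: "3 \<Rightarrow> 3 \<Rightarrow> (3, dep) pt" where "hv i j = (0, axis (H i j) 1)"

text \<open>Up to scaling, the generators of the group preserving the quadratic form of the cone. Together
  with the \<open>x\<close>- and \<open>h\<close>-directions they span the tangent spaces of the cone.\<close>

definition rot :: "real ^ dep \<Rightarrow> 3 \<Rightarrow> 3 \<Rightarrow> (3, dep) pt" where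
  "rot u m k = (u $ L k) *\<^sub>R lv m - (eps m * eps k * u $ L m) *\<^sub>R lv k"

text \<open>Half the differential of the quadratic form of the cone, evaluated at \<open>v\<close>.
  At a cone point with nonzero \<open>l\<close> its kernel is the tangent space of the cone.\<close>

definition tang :: "(3, dep) pt \<Rightarrow> (3, dep) pt \<Rightarrow> bool" where
  "tang z v \<longleftrightarrow> (\<Sum>i\<in>UNIV. eps i * snd z $ L i * snd v $ L i) = 0"

lemma vec_simps:
  "fst (xv k) = axis k 1" "snd (xv k) = 0" "fst (lv i) = 0" "snd (lv i) = axis (L i) 1"
  "fst (hv m n) = 0" "snd (hv m n) = axis (H m n) 1"
  by (simp_all add: xv_def lv_def hv_def)

lemma pt_decomp:
  assumes d: "i \<noteq> j" "j \<noteq> k" "i \<noteq> k"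
  shows "v = fst v $ i *\<^sub>R xv i + fst v $ j *\<^sub>R xv j + fst v $ k *\<^sub>R xv k
    + snd v $ L i *\<^sub>R lv i + snd v $ L j *\<^sub>R lv j + snd v $ L k *\<^sub>R lv k
    + snd v $ H i j *\<^sub>R hv i j + snd v $ H j i *\<^sub>R hv j i
    + snd v $ H i k *\<^sub>R hv i k + snd v $ H k i *\<^sub>R hv k i
    + snd v $ H j k *\<^sub>R hv j k + snd v $ H k j *\<^sub>R hv k j" (is "v = ?r")
proof (rule prod_eqI)
  note neq = d d[symmetric]
  show "fst v = fst ?r"
  proof (simp only: vec_eq_iff, intro allI)
    fix m show "fst v $ m = fst ?r $ m"
      using neq by (cases m rule: cases_3_distinct[OF d]) (simp_all add: vec_simps axis_def)
  qed
  show "snd v = snd ?r"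
  proof (simp only: vec_eq_iff, intro allI)
    fix \<alpha>
    show "snd v $ \<alpha> = snd ?r $ \<alpha>"
    proof (cases \<alpha> rule: dep_cases)
      case (1 m) then show ?thesis using neq
        by (cases m rule: cases_3_distinct[OF d]) (simp_all add: vec_simps axis_def)
    next
      case (2 m n) then show ?thesis using neq
        by (cases m rule: cases_3_distinct[OF d]; cases n rule: cases_3_distinct[OF d])
          (simp_all add: vec_simps axis_def H_eq_iff)
    qed
  qed
qed

text \<open>Tangency determines the \<open>L k\<close> component of \<open>v\<close> from the other
  two, since \<open>u $ L k\<close> can be divided by. The \<open>l\<close> part is then a
  combination of the two rotations that move \<open>L i\<close> and \<open>L j\<close> against
  \<open>L k\<close>.\<close>

lemma tang_decomp:
  assumes d: "i \<noteq> j" "j \<noteq> k" "i \<noteq> k" and t: "tang (x, u) v" and nonzero_L: "u $ L k \<noteq> 0"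
  shows "v = fst v $ i *\<^sub>R xv i + fst v $ j *\<^sub>R xv j + fst v $ k *\<^sub>R xv k
    + (snd v $ L i / u $ L k) *\<^sub>R rot u i k + (snd v $ L j / u $ L k) *\<^sub>R rot u j k
    + snd v $ H i j *\<^sub>R hv i j + snd v $ H j i *\<^sub>R hv j i
    + snd v $ H i k *\<^sub>R hv i k + snd v $ H k i *\<^sub>R hv k i
    + snd v $ H j k *\<^sub>R hv j k + snd v $ H k j *\<^sub>R hv k j"
proof -
  have "eps k * (eps i * u $ L i * snd v $ L i + eps j * u $ L j * snd v $ L j + eps k * u $ L k * snd v $ L k) = 0"
    using t by (simp add: tang_def sum_3_distinct[OF d])
  then have "snd v $ L k = - (snd v $ L i / u $ L k * (eps i * eps k * u $ L i)
      + snd v $ L j / u $ L k * (eps j * eps k * u $ L j))"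
    using nonzero_L by (simp add: field_simps)
  then have e: "snd v $ L i *\<^sub>R lv i + snd v $ L j *\<^sub>R lv j + snd v $ L k *\<^sub>R lv k
     = (snd v $ L i / u $ L k) *\<^sub>R rot u i k + (snd v $ L j / u $ L k) *\<^sub>R rot u j k"
    using nonzero_L unfolding rot_def by (simp only:) (simp add: algebra_simps)
  \<comment> \<open>Brackets the three \<open>l\<close> summands so that \<open>e\<close> can
    replace them as a block.\<close>
  have r: "a + b + c + d + e + f + g = a + b + c + (d + e + f) + g" for a b c d e f g :: "(3, dep) pt"
    by (simp add: add.assoc)
  show ?thesis by (subst pt_decomp[OF d, of v]) (simp only: r e, simp only: add.assoc)
qed

lemma tang_simps [simp]:
  "tang z (xv k)" "tang z (hv m n)" "tang (x, u) (rot u m k)"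
proof -
  show "tang z (xv k)" "tang z (hv m n)" by (simp_all add: tang_def vec_simps axis_def)
  show "tang (x, u) (rot u m k)"
  proof (cases "m = k")
    case False
    obtain i where "i \<noteq> m" "i \<noteq> k" by (rule third_index)
    then show ?thesis
      using False by (simp add: sum_3_distinct[of m k i] tang_def rot_def vec_simps axis_def)
  qed (simp add: tang_def rot_def vec_simps axis_def)
qed

lemma rot_swap: "rot u k m = - (eps m * eps k) *\<^sub>R rot u m k"
  by (simp add: rot_def algebra_simps)

text \<open>Only the differential equations enter, for all orderings of the indices. The algebraic
  relation restricts the point and not the derivatives, so it is kept apart in
  \<open>lame_cone\<close>.\<close>

definition lame_jet :: "real ^ dep \<Rightarrow> real ^ 3 ^ dep \<Rightarrow> bool" where
  "lame_jet u w \<longleftrightarrow> (\<forall>i j k. i \<noteq> j \<and> j \<noteq> k \<and> i \<noteq> k \<longrightarrow>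
     w $ L i $ j = u $ H i j * u $ L j \<and>
     eps i * w $ L i $ i + eps j * u $ H j i * u $ L j + eps k * u $ H k i * u $ L k = 0 \<and>
     w $ H i j $ k = u $ H i k * u $ H k j \<and>
     w $ H i j $ j + w $ H j i $ i + u $ H i k * u $ H j k = 0 \<and>
     eps i * w $ H i j $ i + eps j * w $ H j i $ j + eps k * u $ H k i * u $ H k j = 0)"

lemma lame_cone_iff:
  assumes d: "i \<noteq> j" "j \<noteq> k" "i \<noteq> k"
  shows "(x, u) \<in> lame_cone \<longleftrightarrow>
    eps i * (u $ L i)\<^sup>2 + eps j * (u $ L j)\<^sup>2 + eps k * (u $ L k)\<^sup>2 = 0"
proof -
  have "(x, u) \<in> lame_cone \<longleftrightarrow> (\<Sum>r\<in>UNIV. eps r * (u $ L r)\<^sup>2) = 0"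
    by (simp add: sum_3_distinct[of 1 2 3] lame_cone_def eps_def)
  then show ?thesis by (simp add: sum_3_distinct[OF d])
qed

lemma lame_systemI:
  assumes "(x, u) \<in> lame_cone" "lame_jet u w" "\<Delta> \<in> lame_system"
  shows "\<Delta> (x, u, w) = 0"
proof -
  from assms(3) obtain i j k where d: "i \<noteq> j" "j \<noteq> k" "i \<noteq> k" and D: "\<Delta> \<in> lame_equations i j k"
    by (auto simp: lame_system_def)
  from assms(2)[unfolded lame_jet_def, rule_format, of i j k] d D assms(1) show ?thesis
    by (auto simp: lame_equations_def lame_cone_iff[OF d])
qed

definition jcol :: "real ^ 3 ^ dep \<Rightarrow> 3 \<Rightarrow> (3, dep) pt" where
  "jcol Z k = (0, \<chi> \<alpha>. Z $ \<alpha> $ k)"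

text \<open>The total derivative \<open>D_k\<close> at a jet is the ordinary derivative along this
  vector; \<open>jcol Z k\<close> is the change of the vector when \<open>Z\<close> is added to the
  jet.\<close>

definition jdir :: "real ^ 3 ^ dep \<Rightarrow> 3 \<Rightarrow> (3, dep) pt" where
  "jdir w k = (axis k 1, \<chi> \<alpha>. w $ \<alpha> $ k)"

lemma jdir_add: "jdir (w + Z) k = jdir w k + jcol Z k"
  by (simp add: jdir_def jcol_def vec_eq_iff)

text \<open>The equations for the derivatives of \<open>l\<close> make \<open>tang\<close> hold for
  \<open>jdir w k\<close>, so \<open>tang_decomp\<close> applies. The entries \<open>h_ij\<close>
  and \<open>h_ji\<close> without the index \<open>k\<close> have prescribed derivatives; the four
  entries containing \<open>k\<close> keep their jet coordinates.\<close>

lemma jdir_decomp: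
  assumes d: "i \<noteq> j" "j \<noteq> k" "i \<noteq> k" and w: "lame_jet u w" and nonzero_L: "u $ L k \<noteq> 0"
  shows "jdir w k = xv k + u $ H i k *\<^sub>R rot u i k + u $ H j k *\<^sub>R rot u j k
    + (u $ H i k * u $ H k j) *\<^sub>R hv i j + (u $ H j k * u $ H k i) *\<^sub>R hv j i
    + w $ H i k $ k *\<^sub>R hv i k + w $ H k i $ k *\<^sub>R hv k i
    + w $ H j k $ k *\<^sub>R hv j k + w $ H k j $ k *\<^sub>R hv k j"
    and "tang (x, u) (jdir w k)"
proof -
  note neq = d d[symmetric]
  note 1 = w[unfolded lame_jet_def, rule_format, of i k j] w[unfolded lame_jet_def, rule_format, of j k i]
    w[unfolded lame_jet_def, rule_format, of k i j]
    w[unfolded lame_jet_def, rule_format, of i j k] w[unfolded lame_jet_def, rule_format, of j i k]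
  then have e: "eps k * w $ L k $ k = - (eps i * u $ H i k * u $ L i + eps j * u $ H j k * u $ L j)"
    using neq by auto
  have "eps i * u $ L i * (u $ H i k * u $ L k) + eps j * u $ L j * (u $ H j k * u $ L k)
    + (eps k * w $ L k $ k) * u $ L k = 0" unfolding e by (simp add: algebra_simps)
  then show t: "tang (x, u) (jdir w k)"
    using 1 neq by (simp add: tang_def sum_3_distinct[OF d] jdir_def algebra_simps)
  show "jdir w k = xv k + u $ H i k *\<^sub>R rot u i k + u $ H j k *\<^sub>R rot u j k
    + (u $ H i k * u $ H k j) *\<^sub>R hv i j + (u $ H j k * u $ H k i) *\<^sub>R hv j i
    + w $ H i k $ k *\<^sub>R hv i k + w $ H k i $ k *\<^sub>R hv k i
    + w $ H j k $ k *\<^sub>R hv j k + w $ H k j $ k *\<^sub>R hv k j"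
    by (subst tang_decomp[OF d t nonzero_L]) (use 1 neq nonzero_L in \<open>simp add: jdir_def axis_def\<close>)
qed

text \<open>Differences of two solution jets over the same point.\<close>

definition jet_kernel :: "real ^ 3 ^ dep \<Rightarrow> bool" where
  "jet_kernel Z \<longleftrightarrow> (\<forall>i j k. i \<noteq> j \<and> j \<noteq> k \<and> i \<noteq> k \<longrightarrow>
     Z $ L i = 0 \<and> Z $ H i j $ k = 0 \<and> Z $ H i j $ j + Z $ H j i $ i = 0 \<and>
     eps i * Z $ H i j $ i + eps j * Z $ H j i $ j = 0)"

lemma lame_jet_add: "lame_jet u w \<Longrightarrow> jet_kernel Z \<Longrightarrow> lame_jet u (w + Z)"
  unfolding jet_kernel_def lame_jet_def by (simp add: algebra_simps) (smt (verit))

text \<open>For each unordered pair of indices, the two equations that contain a sum of two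
  derivatives leave one free direction each. This one moves the derivative of \<open>h_mn\<close> by
  its last index against that of \<open>h_nm\<close> by its last index.
  \<open>free_jet_first\<close> does so for the first indices; its \<open>eps\<close> factors cancel
  those of the weighted equation.\<close>

definition free_jet_last :: "3 \<Rightarrow> 3 \<Rightarrow> real ^ 3 ^ dep" where
  "free_jet_last m n = (\<chi> \<alpha> k. if \<alpha> = H m n \<and> k = n then 1 else if \<alpha> = H n m \<and> k = m then - 1 else 0)"

definition free_jet_first :: "3 \<Rightarrow> 3 \<Rightarrow> real ^ 3 ^ dep" where
  "free_jet_first m n = (\<chi> \<alpha> k. if \<alpha> = H m n \<and> k = m then eps m
     else if \<alpha> = H n m \<and> k = n then - eps n else 0)"

lemma jet_kernel_free_jet_last: "m \<noteq> n \<Longrightarrow> jet_kernel (free_jet_last m n)"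
  unfolding jet_kernel_def free_jet_last_def by (auto simp: H_eq_iff vec_eq_iff)

lemma jet_kernel_free_jet_first: "m \<noteq> n \<Longrightarrow> jet_kernel (free_jet_first m n)"
  unfolding jet_kernel_def free_jet_first_def by (auto simp: H_eq_iff vec_eq_iff)

lemma jcol_free_jet_last: "m \<noteq> n \<Longrightarrow> jcol (free_jet_last m n) k = (if k = n then hv m n else if k = m then - hv n m else 0)"
  by (auto simp: jcol_def free_jet_last_def hv_def vec_eq_iff axis_def zero_prod_def)

lemma jcol_free_jet_first: "m \<noteq> n \<Longrightarrow> jcol (free_jet_first m n) k = (if k = m then eps m *\<^sub>R hv m n
   else if k = n then - eps n *\<^sub>R hv n m else 0)"
  by (auto simp: jcol_def free_jet_first_def hv_def vec_eq_iff axis_def H_eq_iff zero_prod_def)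

definition third :: "3 \<Rightarrow> 3 \<Rightarrow> 3" where "third i j = (SOME k. k \<noteq> i \<and> k \<noteq> j)"

lemma third_eq: "i \<noteq> j \<Longrightarrow> j \<noteq> k \<Longrightarrow> i \<noteq> k \<Longrightarrow> third i j = k"
  unfolding third_def by (rule some_equality) (auto intro: cases_3_distinct[of i j k])

text \<open>For fixed \<open>u\<close> the equations are linear in the derivatives, and up to
  interchanging indices each derivative occurs in just one of them, so no compatibility condition
  arises.\<close>

lemma lame_jet_exists: "\<exists>w. lame_jet u w"
proof -
  \<comment> \<open>Where an equation prescribes a sum of two derivatives, both summands get half of
    the value; hence the divisions by 2.\<close>
  define w :: "real ^ 3 ^ dep" where "w = (\<chi> \<alpha> k. case \<alpha> of
      Inl i \<Rightarrow> if k = i then - eps i * (\<Sum>m\<in>UNIV - {i}. eps m * u $ H m i * u $ L m) else u $ H i k * u $ L k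
    | Inr p \<Rightarrow> (case Rep_offdiag p of (i, j) \<Rightarrow>
        if k = j then - u $ H i (third i j) * u $ H j (third i j) / 2
        else if k = i then - eps i * eps (third i j) * u $ H (third i j) i * u $ H (third i j) j / 2
        else u $ H i k * u $ H k j))"
  have Hw: "w $ H i j $ k = (if k = j then - u $ H i (third i j) * u $ H j (third i j) / 2
        else if k = i then - eps i * eps (third i j) * u $ H (third i j) i * u $ H (third i j) j / 2
        else u $ H i k * u $ H k j)" if "i \<noteq> j" for i j k
    using that by (simp add: w_def H_def Abs_offdiag_inverse)
  have Lw: "w $ L i $ k = (if k = i then - eps i * (\<Sum>m\<in>UNIV - {i}. eps m * u $ H m i * u $ L m) else u $ H i k * u $ L k)" for i k
    by (simp add: w_def)
  have "lame_jet u w" unfolding lame_jet_def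
  proof (intro allI impI, elim conjE)
    fix i j k :: 3 assume d: "i \<noteq> j" "j \<noteq> k" "i \<noteq> k"
    have S: "(\<Sum>m\<in>UNIV - {i}. f m) = f j + f k" for f :: "3 \<Rightarrow> real"
      using sum_3_distinct[OF d, of f] by (simp add: sum_diff1)
    have T: "third i j = k" "third j i = k" using d by (auto intro: third_eq)
    show "w $ L i $ j = u $ H i j * u $ L j \<and>
     eps i * w $ L i $ i + eps j * u $ H j i * u $ L j + eps k * u $ H k i * u $ L k = 0 \<and>
     w $ H i j $ k = u $ H i k * u $ H k j \<and>
     w $ H i j $ j + w $ H j i $ i + u $ H i k * u $ H j k = 0 \<and>
     eps i * w $ H i j $ i + eps j * w $ H j i $ j + eps k * u $ H k i * u $ H k j = 0"
      using d by (simp add: Lw Hw S T algebra_simps)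
  qed
  then show ?thesis by blast
qed

section \<open>A local retraction onto the cone\<close>

text \<open>Solves the cone relation for \<open>l\<^sub>2\<close>. Here \<open>s\<close> is the sign of \<open>l\<^sub>2\<close>.\<close>

definition retr :: "real \<Rightarrow> (3, dep) pt \<Rightarrow> (3, dep) pt" where
  "retr s z = z + (s * sqrt ((snd z $ L 1)\<^sup>2 + (snd z $ L 3)\<^sup>2) - snd z $ L 2) *\<^sub>R lv 2"

lemma retr_simps [simp]:
  "snd (retr s z) $ L 1 = snd z $ L 1"
  "snd (retr s z) $ L 2 = s * sqrt ((snd z $ L 1)\<^sup>2 + (snd z $ L 3)\<^sup>2)"
  "snd (retr s z) $ L 3 = snd z $ L 3"
  by (simp_all add: retr_def vec_simps axis_def)

lemma retr_in_cone: "s\<^sup>2 = 1 \<Longrightarrow> retr s z \<in> lame_cone"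
  by (cases "retr s z") (use retr_simps[of s z] in \<open>simp add: lame_cone_def power_mult_distrib\<close>)

lemma retr_id:
  assumes "z \<in> lame_cone" "s * snd z $ L 2 > 0" "s\<^sup>2 = 1"
  shows "retr s z = z"
proof -
  have "(snd z $ L 1)\<^sup>2 - (snd z $ L 2)\<^sup>2 + (snd z $ L 3)\<^sup>2 = 0"
    using assms(1) by (auto simp: lame_cone_def)
  then have "(snd z $ L 1)\<^sup>2 + (snd z $ L 3)\<^sup>2 = (s * snd z $ L 2)\<^sup>2"
    unfolding power_mult_distrib assms(3) by linarith
  moreover have "sqrt ((s * snd z $ L 2)\<^sup>2) = s * snd z $ L 2"
    using assms(2) by (intro real_sqrt_unique) auto
  moreover have "s * (s * snd z $ L 2) = snd z $ L 2"
    using assms(3) by (metis mult.assoc mult_1 power2_eq_square)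
  ultimately show ?thesis by (simp only: retr_def diff_self scaleR_zero_left add_0_right)
qed

lemma has_derivative_retr:
  fixes z :: "(3, dep) pt"
  defines "q \<equiv> sqrt ((snd z $ L 1)\<^sup>2 + (snd z $ L 3)\<^sup>2)"
  assumes "(snd z $ L 1)\<^sup>2 + (snd z $ L 3)\<^sup>2 > 0"
  shows "(retr s has_derivative (\<lambda>v. v + (s * ((snd z $ L 1 * snd v $ L 1 + snd z $ L 3 * snd v $ L 3) / q)
     - snd v $ L 2) *\<^sub>R lv 2)) (at z)"
proof -
  have half: "2 * S * (inverse p / 2) = S / p" for S p :: real by (simp add: inverse_eq_divide)
  have c: "((\<lambda>z. snd z $ L i) has_derivative (\<lambda>v. snd v $ L i)) (at z)" for i
    by (intro bounded_linear_imp_has_derivative bounded_linear_compose[OF bounded_linear_vec_nth bounded_linear_snd])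
  have "((\<lambda>z. (snd z $ L 1)\<^sup>2 + (snd z $ L 3)\<^sup>2) has_derivative
     (\<lambda>v. 2 * (snd z $ L 1 * snd v $ L 1 + snd z $ L 3 * snd v $ L 3))) (at z)"
    by (rule has_derivative_eq_rhs, rule has_derivative_add[OF has_derivative_power[OF c] has_derivative_power[OF c]])
       (auto simp: fun_eq_iff)
  from DERIV_compose_FDERIV[OF DERIV_real_sqrt[OF assms(2)] this]
  have r: "((\<lambda>z. sqrt ((snd z $ L 1)\<^sup>2 + (snd z $ L 3)\<^sup>2)) has_derivative
     (\<lambda>v. (snd z $ L 1 * snd v $ L 1 + snd z $ L 3 * snd v $ L 3) / q)) (at z)"
    by (rule has_derivative_eq_rhs) (simp only: q_def fun_eq_iff half, simp)
  show ?thesis unfolding retr_def[abs_def]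
    by (rule has_derivative_add[OF has_derivative_ident has_derivative_scaleR_left[OF
       has_derivative_diff[OF has_derivative_mult_right[OF r] c]]])
qed

text \<open>The map is \<open>retr\<close> for the sign of \<open>l_2\<close> at \<open>z0\<close>.
  It changes only the \<open>l_2\<close> component, so \<open>x\<close> velocities survive, and its
  values lie on the cone, so its derivative takes tangent values. It serves to push line segments
  onto the cone.\<close>

lemma local_retraction:
  assumes "open M" and z0: "z0 \<in> M \<inter> lame_cone" "snd z0 $ L 2 \<noteq> 0"
  shows "\<exists>r>0. \<exists>\<rho>. \<forall>z\<in>ball z0 r. \<rho> z \<in> M \<inter> lame_cone \<and>
      (z \<in> lame_cone \<longrightarrow> \<rho> z = z) \<and>
      (\<exists>\<rho>'. (\<rho> has_derivative \<rho>') (at z) \<and>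
        (\<forall>v. tang (\<rho> z) (\<rho>' v) \<and> fst (\<rho>' v) = fst v) \<and>
        (z \<in> lame_cone \<longrightarrow> (\<forall>v. tang z v \<longrightarrow> \<rho>' v = v)))"
proof -
  define s where "s = sgn (snd z0 $ L 2)"
  have s: "s\<^sup>2 = 1" "s * snd z0 $ L 2 > 0"
    using z0(2) unfolding s_def by (cases "snd z0 $ L 2 > 0"; simp)+
  have ss1: "s * s = 1" using s(1) by (simp add: power2_eq_square)
  have ss: "s * s = 1" "s * (s * x) = x" for x
    using ss1 mult.assoc[of s s x] by simp_all
  \<comment> \<open>The square root in \<open>retr\<close> is differentiable away from
    \<open>l_1 = l_3 = 0\<close>, a case that the cone relation excludes because \<open>l_2\<close>
    is nonzero.\<close>
  have pos: "(snd z0 $ L 1)\<^sup>2 + (snd z0 $ L 3)\<^sup>2 > 0"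
  proof -
    have "(snd z0 $ L 1)\<^sup>2 - (snd z0 $ L 2)\<^sup>2 + (snd z0 $ L 3)\<^sup>2 = 0"
      using z0 by (auto simp: lame_cone_def)
    moreover have "(snd z0 $ L 2)\<^sup>2 > 0" using z0(2) by simp
    ultimately show ?thesis by linarith
  qed
  \<comment> \<open>As \<open>z0\<close> is fixed, continuity makes a whole neighbourhood of it land
    in \<open>M\<close>.\<close>
  have id0: "retr s z0 = z0" using z0 s by (intro retr_id) simp_all
  have "isCont (retr s) z0" using has_derivative_continuous[OF has_derivative_retr[OF pos]] .
  then have "(retr s \<longlongrightarrow> z0) (nhds z0)"
    using id0 by (metis isCont_def tendsto_at_iff_tendsto_nhds)
  from topological_tendstoD[OF this assms(1)] have "\<forall>\<^sub>F z in nhds z0. retr s z \<in> M"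
    using z0 by simp
  moreover have "\<forall>\<^sub>F z in nhds z0. s * snd z $ L 2 > 0"
    by (rule order_tendstoD(1)[OF _ s(2)]) (intro tendsto_intros filterlim_ident)
  moreover have "\<forall>\<^sub>F z in nhds z0. (snd z $ L 1)\<^sup>2 + (snd z $ L 3)\<^sup>2 > 0"
    by (rule order_tendstoD(1)[OF _ pos]) (intro tendsto_intros filterlim_ident)
  ultimately have "\<forall>\<^sub>F z in nhds z0. retr s z \<in> M \<and> s * snd z $ L 2 > 0 \<and>
      (snd z $ L 1)\<^sup>2 + (snd z $ L 3)\<^sup>2 > 0"
    by eventually_elim auto
  then obtain r where r: "r > 0" "\<And>z. z \<in> ball z0 r \<Longrightarrow> retr s z \<in> M \<and> s * snd z $ L 2 > 0 \<and>
      (snd z $ L 1)\<^sup>2 + (snd z $ L 3)\<^sup>2 > 0"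
    by (auto simp: eventually_nhds_metric dist_commute)
  show ?thesis
  proof (rule exI[of _ r], rule conjI[OF r(1)], rule exI[of _ "retr s"], rule ballI)
    fix z assume z: "z \<in> ball z0 r"
    have 1: "retr s z \<in> M \<inter> lame_cone" using r(2)[OF z] retr_in_cone[OF s(1)] by blast
    have 2: "z \<in> lame_cone \<longrightarrow> retr s z = z" using r(2)[OF z] s(1) by (intro impI retr_id) blast+
    have pos_z: "(snd z $ L 1)\<^sup>2 + (snd z $ L 3)\<^sup>2 > 0" and s2: "s * snd z $ L 2 > 0"
      using r(2)[OF z] by blast+
    define q where "q = sqrt ((snd z $ L 1)\<^sup>2 + (snd z $ L 3)\<^sup>2)"
    define S where "S v = snd z $ L 1 * snd v $ L 1 + snd z $ L 3 * snd v $ L 3" for v :: "(3, dep) pt"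
    have q0: "q \<noteq> 0" unfolding q_def using pos_z by (metis less_irrefl real_sqrt_eq_zero_cancel_iff)
    let ?d = "\<lambda>v. v + (s * (S v / q) - snd v $ L 2) *\<^sub>R lv 2"
    have L2: "snd (retr s z) $ L 2 = s * q" by (simp add: q_def)
    have "tang (retr s z) (?d v)" for v
    proof -
      have "s * q * (s * (S v / q)) = S v" using q0 by (simp add: ss)
      then show ?thesis
        by (simp add: tang_def sum_3_distinct[of 1 2 3] eps_def vec_simps axis_def L2 S_def
            del: retr_simps(2))
    qed
    \<comment> \<open>On this sheet of the cone \<open>l_2 = s * q\<close>, so tangency of
      \<open>v\<close> says that the correction term of the derivative is zero.\<close>
    moreover have "?d v = v" if "z \<in> lame_cone" "tang z v" for v
    proof -
      have "retr s z = z" using that s2 s(1) by (intro retr_id)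
      then have e: "snd z $ L 2 = s * q" using L2 by metis
      have "S v = s * q * snd v $ L 2"
        using that(2) by (simp add: tang_def sum_3_distinct[of 1 2 3] eps_def e S_def)
      then have "s * (S v / q) = snd v $ L 2" using q0 by (simp add: ss mult.assoc)
      then show ?thesis by simp
    qed
    moreover have "fst (?d v) = fst v" for v by (simp add: vec_simps)
    ultimately have "\<exists>\<rho>'. (retr s has_derivative \<rho>') (at z) \<and>
      (\<forall>v. tang (retr s z) (\<rho>' v) \<and> fst (\<rho>' v) = fst v) \<and>
      (z \<in> lame_cone \<longrightarrow> (\<forall>v. tang z v \<longrightarrow> \<rho>' v = v))"
      using has_derivative_retr[OF pos_z, of s, folded q_def S_def] by (intro exI[of _ ?d]) blast
    with 1 2 show "retr s z \<in> M \<inter> lame_cone \<and> (z \<in> lame_cone \<longrightarrow> retr s z = z) \<and>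
      (\<exists>\<rho>'. (retr s has_derivative \<rho>') (at z) \<and>
        (\<forall>v. tang (retr s z) (\<rho>' v) \<and> fst (\<rho>' v) = fst v) \<and>
        (z \<in> lame_cone \<longrightarrow> (\<forall>v. tang z v \<longrightarrow> \<rho>' v = v)))" by blast
  qed
qed

section \<open>Directional derivatives and linearized equations\<close>

abbreviation dd :: "('a::real_normed_vector \<Rightarrow> 'b::real_normed_vector) \<Rightarrow> 'a \<Rightarrow> 'a \<Rightarrow> 'b" where
  "dd f z v \<equiv> frechet_derivative f (at z) v"

lemma dd_linear:
  assumes "f differentiable (at z)"
  shows "dd f z (v + w) = dd f z v + dd f z w" "dd f z (v - w) = dd f z v - dd f z w"
    "dd f z (c *\<^sub>R v) = c *\<^sub>R dd f z v" "dd f z (- v) = - dd f z v" "dd f z 0 = 0"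
    "dd f z (sum g A) = (\<Sum>a\<in>A. dd f z (g a))"
  using linear_frechet_derivative[OF assms]
  by (simp_all add: linear_add linear_diff linear_cmul linear_neg linear_0 linear_sum)

lemma dd_compose:
  assumes "f differentiable (at (g t))" "(g has_derivative g') (at t)"
  shows "((\<lambda>t. f (g t)) has_derivative (\<lambda>v. dd f (g t) (g' v))) (at t)"
  using diff_chain_at[OF assms(2) frechet_derivative_works[THEN iffD1, OF assms(1)]]
  by (simp add: o_def)

lemma total_deriv_jdir:
  assumes "f differentiable (at (x, u))"
  shows "total_deriv k f (x, u, w) = dd f (x, u) (jdir w k)"
proof -
  have "jdir w k = (axis k 1, 0) + (\<Sum>\<alpha>\<in>UNIV. w $ \<alpha> $ k *\<^sub>R (0, axis \<alpha> 1))"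
    by (simp add: jdir_def sum_prod zero_prod_def[symmetric] vec_eq_iff axis_def if_distrib cong: if_cong)
  then show ?thesis
    by (simp only: total_deriv_def prod.case dd_linear[OF assms] real_scaleR_def)
qed

lemma lame_derivs:
  shows "frechet_derivative (\<lambda>(x, u, w :: real ^ 3 ^ dep). a * (u $ L i)\<^sup>2 + b * (u $ L j)\<^sup>2 + c * (u $ L k)\<^sup>2) (at (x :: real ^ 3, u, w)) (y, v, p)
     = 2 * (a * u $ L i * v $ L i + b * u $ L j * v $ L j + c * u $ L k * v $ L k)"
   and "frechet_derivative (\<lambda>(x, u, w). w $ L i $ j - u $ H i j * u $ L j) (at (x :: real ^ 3, u, w)) (y, v, p)
     = p $ L i $ j - (v $ H i j * u $ L j + u $ H i j * v $ L j)"
   and "frechet_derivative (\<lambda>(x, u, w). a * w $ L i $ i + b * u $ H j i * u $ L j + c * u $ H k i * u $ L k)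
       (at (x :: real ^ 3, u, w)) (y, v, p)
     = a * p $ L i $ i + b * (v $ H j i * u $ L j + u $ H j i * v $ L j) + c * (v $ H k i * u $ L k + u $ H k i * v $ L k)"
   and "frechet_derivative (\<lambda>(x, u, w). w $ H i j $ k - u $ H i k * u $ H k j) (at (x :: real ^ 3, u, w)) (y, v, p)
     = p $ H i j $ k - (v $ H i k * u $ H k j + u $ H i k * v $ H k j)"
   and "frechet_derivative (\<lambda>(x, u, w). w $ H i j $ j + w $ H j i $ i + u $ H i k * u $ H j k) (at (x :: real ^ 3, u, w)) (y, v, p)
     = p $ H i j $ j + p $ H j i $ i + (v $ H i k * u $ H j k + u $ H i k * v $ H j k)"
proof -
  have U: "((\<lambda>z. fst (snd z) $ \<alpha>) has_derivative (\<lambda>d. fst (snd d) $ \<alpha>)) (at z)"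
    and W: "((\<lambda>z. snd (snd z) $ \<alpha> $ k) has_derivative (\<lambda>d. snd (snd d) $ \<alpha> $ k)) (at z)"
    for \<alpha> k and z :: "(3, dep) jet"
    by (intro bounded_linear_imp_has_derivative bounded_linear_compose[OF bounded_linear_vec_nth]
       bounded_linear_compose[OF bounded_linear_fst] bounded_linear_compose[OF bounded_linear_snd]
       bounded_linear_fst bounded_linear_snd)+
  note I = has_derivative_add has_derivative_diff has_derivative_mult has_derivative_mult_right
     has_derivative_power U W
  note F = frechet_derivative_at[symmetric, THEN fun_cong, THEN trans]
  show "frechet_derivative (\<lambda>(x, u, w :: real ^ 3 ^ dep). a * (u $ L i)\<^sup>2 + b * (u $ L j)\<^sup>2 + c * (u $ L k)\<^sup>2) (at (x :: real ^ 3, u, w)) (y, v, p)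
     = 2 * (a * u $ L i * v $ L i + b * u $ L j * v $ L j + c * u $ L k * v $ L k)"
    unfolding split_beta by (rule F, (rule I)+) (simp add: algebra_simps)
  show "frechet_derivative (\<lambda>(x, u, w). w $ L i $ j - u $ H i j * u $ L j) (at (x :: real ^ 3, u, w)) (y, v, p)
     = p $ L i $ j - (v $ H i j * u $ L j + u $ H i j * v $ L j)"
    unfolding split_beta by (rule F, (rule I)+) (simp add: algebra_simps)
  show "frechet_derivative (\<lambda>(x, u, w). a * w $ L i $ i + b * u $ H j i * u $ L j + c * u $ H k i * u $ L k)
       (at (x :: real ^ 3, u, w)) (y, v, p)
     = a * p $ L i $ i + b * (v $ H j i * u $ L j + u $ H j i * v $ L j) + c * (v $ H k i * u $ L k + u $ H k i * v $ L k)"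
    unfolding split_beta by (rule F, (rule I)+) (simp add: algebra_simps)
  show "frechet_derivative (\<lambda>(x, u, w). w $ H i j $ k - u $ H i k * u $ H k j) (at (x :: real ^ 3, u, w)) (y, v, p)
     = p $ H i j $ k - (v $ H i k * u $ H k j + u $ H i k * v $ H k j)"
    unfolding split_beta by (rule F, (rule I)+) (simp add: algebra_simps)
  show "frechet_derivative (\<lambda>(x, u, w). w $ H i j $ j + w $ H j i $ i + u $ H i k * u $ H j k) (at (x :: real ^ 3, u, w)) (y, v, p)
     = p $ H i j $ j + p $ H j i $ i + (v $ H i k * u $ H j k + u $ H i k * v $ H j k)"
    unfolding split_beta by (rule F, (rule I)+) (simp add: algebra_simps)
qed

text \<open>Zero is a limit point of the real line. This supplies the nonzero step \<open>s\<close>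
  of the finite differences in \<open>h\<close>.\<close>

lemma eventually_nhds_0_nonzero:
  fixes P :: "real \<Rightarrow> bool"
  assumes "\<forall>\<^sub>F s in nhds 0. P s"
  obtains s where "s \<noteq> 0" "P s"
proof -
  have "\<forall>\<^sub>F s in at 0. P s \<and> s \<noteq> 0"
    using assms unfolding eventually_at_filter by eventually_elim simp
  then show ?thesis using eventually_happens[of _ "at (0::real)"] that by auto
qed

text \<open>Both sides are differentiated at \<open>t = 0\<close>. Agreement on the two lines alone
  suffices, so directional derivatives at different points can be compared.\<close>

lemma dd_line:
  fixes f g :: "'a::real_normed_vector \<Rightarrow> real"
  assumes f: "f differentiable (at z)" and g: "g differentiable (at y)"
    and ev: "\<forall>\<^sub>F t in nhds (0::real). f (z + t *\<^sub>R v) = g (y + t *\<^sub>R w) + c * t"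
  shows "dd f z v = dd g y w + c"
proof -
  have l: "((\<lambda>t::real. z + t *\<^sub>R v) has_derivative (\<lambda>t. t *\<^sub>R v)) (at 0)" for z v :: 'a
    by (auto intro!: derivative_eq_intros)
  have 1: "((\<lambda>t. f (z + t *\<^sub>R v)) has_derivative (\<lambda>t. dd f z (t *\<^sub>R v))) (at 0)"
    using dd_compose[OF _ l, of f z v] f by simp
  have "((\<lambda>t. g (y + t *\<^sub>R w)) has_derivative (\<lambda>t. dd g y (t *\<^sub>R w))) (at 0)"
    using dd_compose[OF _ l, of g y w] g by simp
  then have 2: "((\<lambda>t. g (y + t *\<^sub>R w) + c * t) has_derivative (\<lambda>t. dd g y (t *\<^sub>R w) + c * t)) (at 0)"
    by (rule has_derivative_add[OF _ has_derivative_mult_right[OF has_derivative_ident]])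
  have "((\<lambda>t. g (y + t *\<^sub>R w) + c * t) has_derivative (\<lambda>t. dd f z (t *\<^sub>R v))) (at 0)"
  proof (rule has_derivative_transform_eventually[OF 1])
    show "\<forall>\<^sub>F t in at 0. f (z + t *\<^sub>R v) = g (y + t *\<^sub>R w) + c * t"
      unfolding eventually_at_filter using ev by eventually_elim simp
    show "f (z + 0 *\<^sub>R v) = g (y + 0 *\<^sub>R w) + c * 0" using eventually_nhds_x_imp_x[OF ev] .
  qed simp
  from fun_cong[OF has_derivative_unique[OF this 2], of 1] show ?thesis by simp
qed

lemma shift_hv: "(x, u) + s *\<^sub>R hv m n = (x, u + s *\<^sub>R axis (H m n) 1)"
  by (simp add: hv_def)

lemma shift_nth:
  "(u + s *\<^sub>R axis (H m n) 1) $ L i = u $ L i"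
  "m \<noteq> n \<Longrightarrow> a \<noteq> b \<Longrightarrow> (u + s *\<^sub>R axis (H m n) 1) $ H a b = u $ H a b + (if a = m \<and> b = n then s else 0)"
  "rot (u + s *\<^sub>R axis (H m n) 1) i j = rot u i j"
  by (auto simp: axis_def H_eq_iff rot_def)

lemma snd_hv_L: "snd (hv m n) $ L i = 0"
  by (simp add: hv_def axis_def)

lemma kernel_L: "jet_kernel Z \<Longrightarrow> Z $ L i = 0"
  unfolding jet_kernel_def by (metis third_index)

lemma axis_H_nth:
  "axis (H m n) (1::real) $ L i = 0"
  "m \<noteq> n \<Longrightarrow> a \<noteq> b \<Longrightarrow> axis (H m n) (1::real) $ H a b = (if a = m \<and> b = n then 1 else 0)"
  by (auto simp: axis_def H_eq_iff)

lemmas shift_simps = axis_H_nth shift_nth(3)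

section \<open>Infinitesimal symmetries\<close>

text \<open>With \<open>M\<close> as a parameter a second interpretation on a smaller open set is
  possible; the argument for \<open>dilation\<close> relies on it.\<close>

locale lame_symmetry =
  fixes M :: "(3, dep) pt set" and V :: "(3, dep) pt \<Rightarrow> (3, dep) pt"
  assumes open_M: "open M"
    and nonzero_M: "\<And>x u i. (x, u) \<in> M \<Longrightarrow> u $ L i \<noteq> 0"
    and differentiable_V: "\<And>z. z \<in> M \<Longrightarrow> V differentiable (at z)"
    and symmetry: "infinitesimal_symmetry lame_system M V"
begin

abbreviation "N \<equiv> M \<inter> lame_cone"

definition xi :: "3 \<Rightarrow> (3, dep) pt \<Rightarrow> real" where "xi i z = fst (V z) $ i"
definition eta :: "3 \<Rightarrow> (3, dep) pt \<Rightarrow> real" where "eta i z = snd (V z) $ L i"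
definition phi :: "3 \<Rightarrow> 3 \<Rightarrow> (3, dep) pt \<Rightarrow> real" where "phi i j z = snd (V z) $ H i j"

section \<open>Calculus along the cone\<close>

lemma differentiable_comp:
  assumes "z \<in> M"
  shows "(\<lambda>z. fst (V z) $ i) differentiable (at z)" "(\<lambda>z. snd (V z) $ \<alpha>) differentiable (at z)"
proof -
  obtain V' where V': "(V has_derivative V') (at z)"
    using differentiable_V[OF assms] by (auto simp: differentiable_def)
  show "(\<lambda>z. fst (V z) $ i) differentiable (at z)" "(\<lambda>z. snd (V z) $ \<alpha>) differentiable (at z)"
    using bounded_linear.has_derivative[OF bounded_linear_compose[OF bounded_linear_vec_nth bounded_linear_fst] V']
      bounded_linear.has_derivative[OF bounded_linear_compose[OF bounded_linear_vec_nth bounded_linear_snd] V']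
    by (blast intro: differentiableI)+
qed

lemma differentiable_xi: "z \<in> M \<Longrightarrow> xi i differentiable (at z)"
  and differentiable_eta: "z \<in> M \<Longrightarrow> eta i differentiable (at z)"
  and differentiable_phi: "z \<in> M \<Longrightarrow> phi i j differentiable (at z)"
  unfolding xi_def[abs_def] eta_def[abs_def] phi_def[abs_def] using differentiable_comp by auto

text \<open>A straight line with velocity \<open>v\<close> is pushed onto the cone by the local
  retraction. The velocity at \<open>z\<close> survives because the derivative of the retraction
  there fixes tangent vectors.\<close>

lemma curve_through:
  assumes "z \<in> N" "tang z v"
  obtains \<gamma> where "\<gamma> 0 = z" "(\<gamma> has_derivative (\<lambda>t. t *\<^sub>R v)) (at (0::real))" "\<forall>\<^sub>F t in nhds 0. \<gamma> t \<in> N"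
proof -
  have nonzero_L: "snd z $ L 2 \<noteq> 0" using assms(1) nonzero_M[of "fst z" "snd z"] by simp
  obtain r \<rho> where r: "r > 0" and R: "\<forall>y\<in>ball z r. \<rho> y \<in> N \<and>
      (y \<in> lame_cone \<longrightarrow> \<rho> y = y) \<and>
      (\<exists>\<rho>'. (\<rho> has_derivative \<rho>') (at y) \<and>
        (\<forall>v. tang (\<rho> y) (\<rho>' v) \<and> fst (\<rho>' v) = fst v) \<and>
        (y \<in> lame_cone \<longrightarrow> (\<forall>v. tang y v \<longrightarrow> \<rho>' v = v)))"
    using local_retraction[OF open_M assms(1) nonzero_L] by blast
  have d: "\<exists>\<rho>'. (\<rho> has_derivative \<rho>') (at y) \<and>
      (\<forall>v. tang (\<rho> y) (\<rho>' v) \<and> fst (\<rho>' v) = fst v) \<and>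
      (y \<in> lame_cone \<longrightarrow> (\<forall>v. tang y v \<longrightarrow> \<rho>' v = v))" if "y \<in> ball z r" for y
    using R that by blast
  have r: "r > 0" "\<And>y. y \<in> ball z r \<Longrightarrow> \<rho> y \<in> N"
    "\<And>y. y \<in> ball z r \<Longrightarrow> y \<in> lame_cone \<Longrightarrow> \<rho> y = y"
    using r R by blast+
  have z: "z \<in> ball z r" using r by simp
  obtain \<rho>' where \<rho>': "(\<rho> has_derivative \<rho>') (at z)" "\<And>v. tang z v \<Longrightarrow> \<rho>' v = v"
    using d[OF z] assms by auto
  show thesis
  proof
    show "\<rho> (z + 0 *\<^sub>R v) = z" using r(3)[OF z] assms by simp
    have "((\<lambda>t::real. z + t *\<^sub>R v) has_derivative (\<lambda>t. t *\<^sub>R v)) (at 0)"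
      by (auto intro!: derivative_eq_intros)
    from diff_chain_at[OF this, of \<rho> \<rho>']
    have "((\<lambda>t. \<rho> (z + t *\<^sub>R v)) has_derivative (\<lambda>t. \<rho>' (t *\<^sub>R v))) (at 0)"
      using \<rho>'(1) by (simp add: o_def)
    moreover have "\<rho>' (t *\<^sub>R v) = t *\<^sub>R v" for t
      using has_derivative_linear[OF \<rho>'(1)] \<rho>'(2)[OF assms(2)] by (simp add: linear_cmul)
    ultimately show "((\<lambda>t. \<rho> (z + t *\<^sub>R v)) has_derivative (\<lambda>t. t *\<^sub>R v)) (at 0)" by simp
    have "((\<lambda>t::real. z + t *\<^sub>R v) \<longlongrightarrow> z + 0 *\<^sub>R v) (nhds 0)"
      by (intro tendsto_intros filterlim_ident)
    then have "\<forall>\<^sub>F t in nhds (0::real). z + t *\<^sub>R v \<in> ball z r"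
      using z by (intro topological_tendstoD) auto
    then show "\<forall>\<^sub>F t in nhds (0::real). \<rho> (z + t *\<^sub>R v) \<in> N"
      by eventually_elim (use r in auto)
  qed
qed

text \<open>The functions are known to agree only on \<open>N\<close>, so they are compared along a
  curve inside \<open>N\<close> with velocity \<open>v\<close>.\<close>

lemma deriv_transport:
  fixes f g :: "(3, dep) pt \<Rightarrow> real"
  assumes z: "z \<in> N" "tang z v" and "f differentiable (at (z + e))" "g differentiable (at z)"
    and eq: "\<forall>\<^sub>F y in nhds z. y \<in> N \<longrightarrow> f (y + e) = g y"
  shows "dd f (z + e) v = dd g z v"
proof -
  obtain \<gamma> where \<gamma>: "\<gamma> 0 = z" "(\<gamma> has_derivative (\<lambda>t. t *\<^sub>R v)) (at (0::real))"
      "\<forall>\<^sub>F t in nhds 0. \<gamma> t \<in> N" using curve_through[OF z] .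
  have "(\<gamma> \<longlongrightarrow> z) (nhds 0)"
    using has_derivative_continuous[OF \<gamma>(2)] \<gamma>(1) by (metis isCont_def tendsto_at_iff_tendsto_nhds)
  then have "\<forall>\<^sub>F t in nhds 0. \<gamma> t \<in> N \<longrightarrow> f (\<gamma> t + e) = g (\<gamma> t)"
    using eventually_compose_filterlim[OF eq] by blast
  with \<gamma>(3) have ev: "\<forall>\<^sub>F t in nhds 0. f (\<gamma> t + e) = g (\<gamma> t)" by eventually_elim auto
  have "((\<lambda>t. \<gamma> t + e) has_derivative (\<lambda>t. t *\<^sub>R v)) (at 0)"
    using \<gamma>(2) by (auto intro!: derivative_eq_intros)
  from dd_compose[OF _ this, of f] have 1: "((\<lambda>t. f (\<gamma> t + e)) has_derivative (\<lambda>t. dd f (z + e) (t *\<^sub>R v))) (at 0)"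
    using assms(3) \<gamma>(1) by simp
  from dd_compose[OF _ \<gamma>(2), of g] have 2: "((\<lambda>t. g (\<gamma> t)) has_derivative (\<lambda>t. dd g z (t *\<^sub>R v))) (at 0)"
    using assms(4) \<gamma>(1) by simp
  have "((\<lambda>t. g (\<gamma> t)) has_derivative (\<lambda>t. dd f (z + e) (t *\<^sub>R v))) (at 0)"
  proof (rule has_derivative_transform_eventually[OF 1])
    show "\<forall>\<^sub>F t in at 0. f (\<gamma> t + e) = g (\<gamma> t)"
      unfolding eventually_at_filter using ev by eventually_elim simp
    show "f (\<gamma> 0 + e) = g (\<gamma> 0)" using eventually_nhds_x_imp_x[OF ev] .
  qed simp
  from fun_cong[OF has_derivative_unique[OF this 2], of 1]
  have "dd f (z + e) (1 *\<^sub>R v) = dd g z (1 *\<^sub>R v)" .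
  then show ?thesis by simp
qed

text \<open>The segment from \<open>z\<close> to \<open>z'\<close> is retracted onto the cone. The
  \<open>x\<close> velocity is preserved, so only tangent vectors over \<open>fst z' - fst z\<close>
  occur as velocities; hence the result also serves functions whose derivative vanishes in some
  \<open>x\<close> directions only. The radius does not depend on \<open>f\<close>.\<close>

lemma path_const:
  assumes "z0 \<in> N"
  shows "\<exists>r>0. \<forall>(f::(3, dep) pt \<Rightarrow> real) z z'. (\<forall>y\<in>N. f differentiable (at y)) \<longrightarrow>
     z \<in> N \<longrightarrow> z' \<in> N \<longrightarrow> dist z0 z < r \<longrightarrow> dist z0 z' < r \<longrightarrow>
     (\<forall>y\<in>N. \<forall>v. tang y v \<longrightarrow> fst v = fst z' - fst z \<longrightarrow> dd f y v = 0) \<longrightarrow> f z = f z'"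
proof -
  have nonzero_L: "snd z0 $ L 2 \<noteq> 0" using assms(1) nonzero_M[of "fst z0" "snd z0"] by simp
  obtain r \<rho> where r: "r > 0" and R: "\<forall>y\<in>ball z0 r. \<rho> y \<in> N \<and>
      (y \<in> lame_cone \<longrightarrow> \<rho> y = y) \<and>
      (\<exists>\<rho>'. (\<rho> has_derivative \<rho>') (at y) \<and>
        (\<forall>v. tang (\<rho> y) (\<rho>' v) \<and> fst (\<rho>' v) = fst v) \<and>
        (y \<in> lame_cone \<longrightarrow> (\<forall>v. tang y v \<longrightarrow> \<rho>' v = v)))"
    using local_retraction[OF open_M assms(1) nonzero_L] by blast
  have d: "\<exists>\<rho>'. (\<rho> has_derivative \<rho>') (at y) \<and>
      (\<forall>v. tang (\<rho> y) (\<rho>' v) \<and> fst (\<rho>' v) = fst v) \<and>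
      (y \<in> lame_cone \<longrightarrow> (\<forall>v. tang y v \<longrightarrow> \<rho>' v = v))" if "y \<in> ball z0 r" for y
    using R that by blast
  have r: "r > 0" "\<And>y. y \<in> ball z0 r \<Longrightarrow> \<rho> y \<in> N"
    "\<And>y. y \<in> ball z0 r \<Longrightarrow> y \<in> lame_cone \<Longrightarrow> \<rho> y = y"
    using r R by blast+
  show ?thesis
  proof (rule exI[of _ r], rule conjI[OF r(1)], intro allI impI)
    fix f :: "(3, dep) pt \<Rightarrow> real" and z z'
    assume diff: "\<forall>y\<in>N. f differentiable (at y)" and z: "z \<in> N" "z' \<in> N" "dist z0 z < r" "dist z0 z' < r"
      and vanish: "\<forall>y\<in>N. \<forall>v. tang y v \<longrightarrow> fst v = fst z' - fst z \<longrightarrow> dd f y v = 0"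
    have f: "f differentiable (at y)" if "y \<in> N" for y using diff that by blast
    have 0: "dd f y v = 0" if "y \<in> N" "tang y v" "fst v = fst z' - fst z" for y v using vanish that by blast
    have fd: "\<exists>\<rho>'. ((\<lambda>y. f (\<rho> y)) has_derivative (\<lambda>v. dd f (\<rho> y) (\<rho>' v))) (at y) \<and>
       dd f (\<rho> y) (\<rho>' (z' - z)) = 0" if y: "y \<in> ball z0 r" for y
    proof -
      obtain \<rho>' where \<rho>': "(\<rho> has_derivative \<rho>') (at y)" "tang (\<rho> y) (\<rho>' (z' - z))"
        "fst (\<rho>' (z' - z)) = fst (z' - z)" using d[OF y] by blast
      with dd_compose[OF f[OF r(2)[OF y]] \<rho>'(1)] 0[OF r(2)[OF y] \<rho>'(2)] show ?thesis by auto
    qed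
    have "(\<lambda>t::real. f (\<rho> (z + t *\<^sub>R (z' - z)))) 0 = (\<lambda>t::real. f (\<rho> (z + t *\<^sub>R (z' - z)))) 1"
    proof (rule has_derivative_zero_unique[where s = "{0..1}" and x = 0 and y = 1
        and f = "\<lambda>t::real. f (\<rho> (z + t *\<^sub>R (z' - z)))"])
      fix t :: real assume t: "t \<in> {0..1}"
      have "z + t *\<^sub>R (z' - z) = (1 - t) *\<^sub>R z + t *\<^sub>R z'" by (simp add: algebra_simps)
      then have y: "z + t *\<^sub>R (z' - z) \<in> ball z0 r"
        using convexD_alt[OF convex_ball, of z z0 r z' t] z t by simp
      obtain \<rho>' where \<rho>': "((\<lambda>y. f (\<rho> y)) has_derivative (\<lambda>v. dd f (\<rho> (z + t *\<^sub>R (z' - z))) (\<rho>' v))) (at (z + t *\<^sub>R (z' - z)))"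
        "dd f (\<rho> (z + t *\<^sub>R (z' - z))) (\<rho>' (z' - z)) = 0" using fd[OF y] by auto
      have "((\<lambda>t::real. z + t *\<^sub>R (z' - z)) has_derivative (\<lambda>h. h *\<^sub>R (z' - z))) (at t)"
        by (auto intro!: derivative_eq_intros)
      from diff_chain_at[OF this \<rho>'(1)]
      have "((\<lambda>t. f (\<rho> (z + t *\<^sub>R (z' - z)))) has_derivative
        (\<lambda>h. dd f (\<rho> (z + t *\<^sub>R (z' - z))) (\<rho>' (h *\<^sub>R (z' - z))))) (at t)" by (simp add: o_def)
      moreover have "dd f (\<rho> (z + t *\<^sub>R (z' - z))) (\<rho>' (h *\<^sub>R (z' - z))) = 0" for h
        using linear_cmul[OF has_derivative_linear[OF \<rho>'(1)], of h "z' - z"] \<rho>'(2) by simp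
      ultimately show "((\<lambda>t. f (\<rho> (z + t *\<^sub>R (z' - z)))) has_derivative (\<lambda>h. 0)) (at t within {0..1})"
        by (simp add: has_derivative_at_withinI)
    qed auto
    then show "f z = f z'" using r(3)[of z] r(3)[of z'] z by simp
  qed
qed

text \<open>A shift without \<open>l\<close> components preserves the cone relation, so
  \<open>f\<close> is constant on short segments in direction \<open>e\<close>, of a length uniform
  near \<open>z\<close>. By this uniformity \<open>deriv_transport\<close> carries the derivatives
  along, which takes the place of interchanging second derivatives.\<close>

lemma segment_transport:
  fixes f :: "(3, dep) pt \<Rightarrow> real"
  assumes f: "\<And>y. y \<in> N \<Longrightarrow> f differentiable (at y)" and e: "\<And>m. snd e $ L m = 0"
    and 0: "\<And>y. y \<in> N \<Longrightarrow> dd f y e = 0" and z: "z \<in> N"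
  shows "\<forall>\<^sub>F s in nhds (0::real). f (z + s *\<^sub>R e) = f z \<and>
     (\<forall>v. tang z v \<longrightarrow> dd f (z + s *\<^sub>R e) v = dd f z v)"
    and "\<forall>\<^sub>F s in nhds (0::real). z + s *\<^sub>R e \<in> N"
proof -
  \<comment> \<open>One half of the radius is reserved for the base point \<open>y\<close>, the
    other half for the shift.\<close>
  obtain r where r: "r > 0" "ball z (2 * r) \<subseteq> M"
    using open_M z open_contains_ball[of M] by (metis IntD1 field_sum_of_halves half_gt_zero_iff mult_2)
  have N: "y + s *\<^sub>R e \<in> N" if "y \<in> N" "dist z y < r" "norm (s *\<^sub>R e) < r" for y s
  proof -
    have "dist z (y + s *\<^sub>R e) < 2 * r"
      using that dist_triangle[of z "y + s *\<^sub>R e" y] by (simp add: dist_norm norm_minus_commute)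
    moreover have "y + s *\<^sub>R e \<in> lame_cone" using that(1) e by (cases y, cases e) (simp add: lame_cone_def)
    ultimately show ?thesis using r by auto
  qed
  have c: "f (y + s *\<^sub>R e) = f y" if y: "y \<in> N" "dist z y < r" "norm (s *\<^sub>R e) < r" for y s
  proof -
    have "(\<lambda>t::real. f (y + (t * s) *\<^sub>R e)) 0 = (\<lambda>t::real. f (y + (t * s) *\<^sub>R e)) 1"
    proof (rule has_derivative_zero_unique[where s = "{0..1}" and x = 0 and y = 1
        and f = "\<lambda>t::real. f (y + (t * s) *\<^sub>R e)"])
      fix t :: real assume t: "t \<in> {0..1}"
      have "norm ((t * s) *\<^sub>R e) \<le> norm (s *\<^sub>R e)" using t by (simp add: mult_left_le_one_le abs_mult mult.assoc)
      then have yN: "y + (t * s) *\<^sub>R e \<in> N" using y by (intro N) auto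
      have "((\<lambda>t::real. y + (t * s) *\<^sub>R e) has_derivative (\<lambda>h. (h * s) *\<^sub>R e)) (at t)"
        by (auto intro!: derivative_eq_intros)
      from dd_compose[OF f[OF yN] this] dd_linear(3)[OF f[OF yN]] 0[OF yN]
      show "((\<lambda>t. f (y + (t * s) *\<^sub>R e)) has_derivative (\<lambda>h. 0)) (at t within {0..1})"
        by (simp add: has_derivative_at_withinI)
    qed auto
    then show ?thesis by simp
  qed
  have ev: "\<forall>\<^sub>F s in nhds (0::real). norm (s *\<^sub>R e) < r"
  proof (rule order_tendstoD(2))
    show "((\<lambda>s::real. norm (s *\<^sub>R e)) \<longlongrightarrow> norm (0 *\<^sub>R e)) (nhds 0)"
      by (intro tendsto_intros filterlim_ident)
  qed (use r in simp)
  have near: "\<forall>\<^sub>F y in nhds z. dist z y < r"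
    using r by (auto simp: eventually_nhds_metric dist_commute)
  show "\<forall>\<^sub>F s in nhds (0::real). f (z + s *\<^sub>R e) = f z \<and>
     (\<forall>v. tang z v \<longrightarrow> dd f (z + s *\<^sub>R e) v = dd f z v)"
    using ev
  proof eventually_elim
    case (elim s)
    have "\<forall>\<^sub>F y in nhds z. y \<in> N \<longrightarrow> f (y + s *\<^sub>R e) = f y"
      using near by eventually_elim (use c elim in auto)
    moreover have "dist z z < r" using r(1) by simp
    ultimately show ?case
      using c[OF z _ elim] deriv_transport[OF z _ f[OF N[OF z _ elim]] f[OF z]] by blast
  qed
  show "\<forall>\<^sub>F s in nhds (0::real). z + s *\<^sub>R e \<in> N"
    using ev by eventually_elim (use N z r in auto)
qed

section \<open>The prolonged equations\<close>

lemma pr_eqs: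
  fixes x u w
  defines "P \<equiv> \<lambda>\<alpha> k. dd (\<lambda>z. snd (V z) $ \<alpha>) (x, u) (jdir w k)
      - (\<Sum>r\<in>UNIV. dd (xi r) (x, u) (jdir w k) * w $ \<alpha> $ r)"
  assumes z: "(x, u) \<in> N" and w: "lame_jet u w" and d: "i \<noteq> j" "j \<noteq> k" "i \<noteq> k"
  shows "eps i * u $ L i * eta i (x, u) + eps j * u $ L j * eta j (x, u) + eps k * u $ L k * eta k (x, u) = 0"
    and "P (L i) j = phi i j (x, u) * u $ L j + u $ H i j * eta j (x, u)"
    and "eps i * P (L i) i + eps j * (phi j i (x, u) * u $ L j + u $ H j i * eta j (x, u))
         + eps k * (phi k i (x, u) * u $ L k + u $ H k i * eta k (x, u)) = 0"
    and "P (H i j) k = phi i k (x, u) * u $ H k j + u $ H i k * phi k j (x, u)"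
    and "P (H i j) j + P (H j i) i + (phi i k (x, u) * u $ H j k + u $ H i k * phi j k (x, u)) = 0"
proof -
  \<comment> \<open>Identifies \<open>P\<close> with the derivative part of the prolongation, the
    total derivatives being taken along \<open>jdir\<close>.\<close>
  have pr: "prolong1 V (x, u, w) = (fst (V (x, u)), snd (V (x, u)), \<chi> \<alpha> k. P \<alpha> k)"
    using z differentiable_comp[of "(x, u)"]
    by (simp add: prolong1_def P_def total_deriv_jdir xi_def[abs_def])
  have 0: "frechet_derivative \<Delta> (at (x, u, w)) (fst (V (x, u)), snd (V (x, u)), \<chi> \<alpha> k. P \<alpha> k) = 0"
    if "\<Delta> \<in> lame_equations i j k" for \<Delta>
  proof -
    have "\<Delta> \<in> lame_system" using that d by (auto simp: lame_system_def)
    then show ?thesis using symmetry z lame_systemI[OF _ w, of x]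
      unfolding infinitesimal_symmetry_def pr[symmetric] by blast
  qed
  note E = 0[unfolded lame_equations_def]
  show "eps i * u $ L i * eta i (x, u) + eps j * u $ L j * eta j (x, u) + eps k * u $ L k * eta k (x, u) = 0"
    "P (L i) j = phi i j (x, u) * u $ L j + u $ H i j * eta j (x, u)"
    "eps i * P (L i) i + eps j * (phi j i (x, u) * u $ L j + u $ H j i * eta j (x, u))
         + eps k * (phi k i (x, u) * u $ L k + u $ H k i * eta k (x, u)) = 0"
    "P (H i j) k = phi i k (x, u) * u $ H k j + u $ H i k * phi k j (x, u)"
    "P (H i j) j + P (H j i) i + (phi i k (x, u) * u $ H j k + u $ H i k * phi j k (x, u)) = 0"
    using E[OF insertI1]
    using E[OF insertI2, OF insertI1]
    using E[OF insertI2, OF insertI2, OF insertI1]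
    using E[OF insertI2, OF insertI2, OF insertI2, OF insertI1]
    using E[OF insertI2, OF insertI2, OF insertI2, OF insertI2, OF insertI1]
    unfolding lame_derivs eta_def phi_def by auto
qed

lemma eta_abs: "(\<lambda>z. snd (V z) $ L i) = eta i" and phi_abs: "(\<lambda>z. snd (V z) $ H i j) = phi i j"
  by (simp_all add: fun_eq_iff eta_def phi_def)

lemmas pr_eqs' = pr_eqs[unfolded eta_abs phi_abs]

section \<open>Dependence on h, by comparing jets over one point\<close>

lemma dd_components_linear:
  assumes "z \<in> N"
  shows "dd (xi i) z (v + w) = dd (xi i) z v + dd (xi i) z w" "dd (xi i) z (c *\<^sub>R v) = c * dd (xi i) z v"
    "dd (xi i) z (- v) = - dd (xi i) z v" "dd (xi i) z 0 = 0"
    "dd (eta i) z (v + w) = dd (eta i) z v + dd (eta i) z w" "dd (eta i) z (c *\<^sub>R v) = c * dd (eta i) z v"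
    "dd (eta i) z (- v) = - dd (eta i) z v" "dd (eta i) z 0 = 0"
    "dd (phi i j) z (v + w) = dd (phi i j) z v + dd (phi i j) z w" "dd (phi i j) z (c *\<^sub>R v) = c * dd (phi i j) z v"
    "dd (phi i j) z (- v) = - dd (phi i j) z v" "dd (phi i j) z 0 = 0"
  using assms dd_linear[OF differentiable_xi[of z i]] dd_linear[OF differentiable_eta[of z i]]
    dd_linear[OF differentiable_phi[of z i j]] by simp_all

text \<open>With \<open>j\<close> the third index, adding \<open>free_jet_first i j\<close> changes
  the derivative of \<open>h_ij\<close> by \<open>x_i\<close> but not the vector
  \<open>jdir w k\<close>. In the prolonged equation for the derivative of \<open>h_ij\<close> by
  \<open>x_k\<close> only the term with factor \<open>D_k\<close> of \<open>xi i\<close> changes, so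
  this factor vanishes.\<close>

lemma xi_jdir:
  assumes z: "(x, u) \<in> N" and w: "lame_jet u w" and ne: "i \<noteq> k"
  shows "dd (xi i) (x, u) (jdir w k) = 0"
proof -
  obtain j where j: "j \<noteq> i" "j \<noteq> k" by (rule third_index)
  have d: "i \<noteq> j" "j \<noteq> k" "i \<noteq> k" using j ne by auto
  let ?Z = "free_jet_first i j"
  have K: "jet_kernel ?Z" using d by (intro jet_kernel_free_jet_first)
  have c: "jcol ?Z k = 0" using d by (simp add: jcol_free_jet_first)
  have "jdir (w + ?Z) k = jdir w k" by (simp add: jdir_add c)
  moreover have "?Z $ H i j $ i = eps i" "?Z $ H i j $ j = 0" "?Z $ H i j $ k = 0"
    using d by (simp_all add: free_jet_first_def H_eq_iff)
  ultimately have "eps i * dd (xi i) (x, u) (jdir w k) = 0"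
    using pr_eqs'(4)[OF z w d] pr_eqs'(4)[OF z lame_jet_add[OF w K] d]
    by (simp add: sum_3_distinct[OF d] algebra_simps)
  then show ?thesis by simp
qed

text \<open>\<open>xi_jdir\<close> holds on every solution jet, and subtracting two instances leaves
  the derivative along a kernel column. The direction \<open>hv m n\<close> occurs in column
  \<open>n\<close> of \<open>free_jet_last\<close> and in column \<open>m\<close> of
  \<open>free_jet_first\<close>, and \<open>i\<close> differs from \<open>m\<close> or from
  \<open>n\<close>.\<close>

lemma xi_hv:
  assumes z: "z \<in> N" and mn: "m \<noteq> n"
  shows "dd (xi i) z (hv m n) = 0"
proof -
  obtain x u where [simp]: "z = (x, u)" by force
  obtain w where w: "lame_jet u w" using lame_jet_exists by blast
  have *: "dd (xi i) z (jcol Z k) = 0" if "jet_kernel Z" "i \<noteq> k" for Z k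
    using xi_jdir[OF _ w \<open>i \<noteq> k\<close>, of x] xi_jdir[OF _ lame_jet_add[OF w \<open>jet_kernel Z\<close>] \<open>i \<noteq> k\<close>, of x] z dd_components_linear[OF z]
    by (simp add: jdir_add)
  show ?thesis
  proof (cases "i = n")
    case False
    then show ?thesis using *[OF jet_kernel_free_jet_last[OF mn] False] by (simp add: jcol_free_jet_last[OF mn])
  next
    case True
    then have "i \<noteq> m" using mn by simp
    then show ?thesis using *[OF jet_kernel_free_jet_first[OF mn] \<open>i \<noteq> m\<close>] dd_components_linear[OF z]
      by (simp add: jcol_free_jet_first[OF mn])
  qed
qed

text \<open>Adding \<open>free_jet_last m n\<close> moves \<open>jdir w n\<close> by
  \<open>hv m n\<close> and leaves the derivatives of \<open>l\<close> alone. The prolonged equation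
  for the derivative of \<open>l_i\<close> by \<open>x_n\<close> then isolates the claim; for
  \<open>i = n\<close> this is the diagonal equation.\<close>

lemma eta_hv:
  assumes z: "z \<in> N" and mn: "m \<noteq> n"
  shows "dd (eta i) z (hv m n) = 0"
proof -
  obtain x u where zxu: "z = (x, u)" by force
  note z' = z[unfolded zxu]
  obtain w where w: "lame_jet u w" using lame_jet_exists by blast
  note K = jet_kernel_free_jet_last[OF mn]
  have c: "jcol (free_jet_last m n) n = hv m n" by (simp add: jcol_free_jet_last[OF mn])
  have xi: "dd (xi r) (x, u) (hv m n) = 0" for r using xi_hv[OF z' mn] .
  note s = jdir_add c kernel_L[OF K] dd_components_linear[OF z'] xi
  show ?thesis unfolding zxu
  proof (cases "i = n")
    case False
    obtain k where k: "k \<noteq> i" "k \<noteq> n" by (rule third_index)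
    have d: "i \<noteq> n" "n \<noteq> k" "i \<noteq> k" using k False by auto
    show "dd (eta i) (x, u) (hv m n) = 0"
      using pr_eqs'(2)[OF z' w d] pr_eqs'(2)[OF z' lame_jet_add[OF w K] d] by (simp add: s)
  next
    case True
    obtain k where k: "k \<noteq> m" "k \<noteq> n" by (rule third_index)
    have d: "n \<noteq> m" "m \<noteq> k" "n \<noteq> k" using k mn by auto
    have aux: "X = 0" if "e * (A - S) + B + C = 0" "e * (A + X - S) + B + C = 0" "e \<noteq> 0"
      for A B C S X e :: real
    proof -
      have "e * (A + X - S) = e * (A - S) + e * X" by (simp add: algebra_simps)
      then have "e * X = 0" using that(1,2) by linarith
      then show ?thesis using that(3) by simp
    qed
    show "dd (eta i) (x, u) (hv m n) = 0"
      using aux[OF pr_eqs'(3)[OF z' w d] pr_eqs'(3)[OF z' lame_jet_add[OF w K] d, unfolded jdir_add c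
         kernel_L[OF K] vector_add_component add_0_right dd_components_linear(1,5)[OF z'] xi]] True by simp
  qed
qed

text \<open>Since \<open>k\<close> is one of \<open>m\<close> and \<open>n\<close>, a free jet for
  this pair leaves the derivatives of \<open>h_ij\<close> unchanged while its column
  \<open>k\<close> is a multiple of \<open>hv m n\<close>. Only \<open>D_k\<close> of
  \<open>phi i j\<close> changes in the prolonged equation.\<close>

lemma phi_hv:
  assumes z: "z \<in> N" and d: "i \<noteq> j" "j \<noteq> k" "i \<noteq> k" and mn: "m \<noteq> n" "m = k \<or> n = k"
  shows "dd (phi i j) z (hv m n) = 0"
proof -
  obtain x u where zxu: "z = (x, u)" by force
  note z' = z[unfolded zxu]
  obtain w where w: "lame_jet u w" using lame_jet_exists by blast
  have xi: "dd (xi r) (x, u) (hv m n) = 0" for r using xi_hv[OF z' mn(1)] .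
  have *: "dd (phi i j) z (jcol Z k) = 0"
    if K: "jet_kernel Z" and 0: "Z $ H i j = 0" "\<And>r. dd (xi r) z (jcol Z k) = 0" for Z
    using pr_eqs'(4)[OF z' w d] pr_eqs'(4)[OF z' lame_jet_add[OF w K] d] 0 z'
    by (simp add: zxu jdir_add dd_components_linear[OF z'])
  show ?thesis
  proof (cases "n = k")
    case True
    moreover have "free_jet_last m n $ H i j = 0" using True mn d by (simp add: free_jet_last_def H_eq_iff vec_eq_iff)
    moreover have "jcol (free_jet_last m n) k = hv m n" using True jcol_free_jet_last[OF mn(1)] by simp
    ultimately show ?thesis using *[OF jet_kernel_free_jet_last[OF mn(1)]] xi by (simp add: zxu)
  next
    case False
    then have mk: "m = k" using mn by simp
    then have "free_jet_first m n $ H i j = 0" using mn d by (simp add: free_jet_first_def H_eq_iff vec_eq_iff)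
    moreover have "jcol (free_jet_first m n) k = eps k *\<^sub>R hv m n" using mk jcol_free_jet_first[OF mn(1)] by simp
    ultimately show ?thesis using *[OF jet_kernel_free_jet_first[OF mn(1)]] xi by (simp add: zxu dd_components_linear[OF z'])
  qed
qed

section \<open>Invariance under small shifts of h\<close>

definition inv_along :: "((3, dep) pt \<Rightarrow> real) \<Rightarrow> (3, dep) pt \<Rightarrow> (3, dep) pt \<Rightarrow> bool" where
  "inv_along f z y \<longleftrightarrow> f y = f z \<and> (\<forall>v. tang z v \<longrightarrow> dd f y v = dd f z v)"

lemma inv_along_dest:
  "inv_along f (x, u) y \<Longrightarrow> f y = f (x, u)"
  "inv_along f (x, u) y \<Longrightarrow> dd f y (xv k) = dd f (x, u) (xv k)"
  "inv_along f (x, u) y \<Longrightarrow> dd f y (rot u i j) = dd f (x, u) (rot u i j)"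
  unfolding inv_along_def using tang_simps by blast+

text \<open>The cone relation involves only \<open>l\<close>, and the derivatives of
  \<open>xi\<close> and \<open>eta\<close> along \<open>hv m n\<close> vanish on all of
  \<open>N\<close>, so \<open>segment_transport\<close> applies. These facts keep the coefficients
  fixed when equations at shifted points are subtracted.\<close>

lemma
  assumes "(x, u) \<in> N" "m \<noteq> n"
  shows ev_N: "\<forall>\<^sub>F s in nhds (0::real). (x, u + s *\<^sub>R axis (H m n) 1) \<in> N"
    and ev_xi: "\<forall>\<^sub>F s in nhds (0::real). inv_along (xi i) (x, u) (x, u + s *\<^sub>R axis (H m n) 1)"
    and ev_eta: "\<forall>\<^sub>F s in nhds (0::real). inv_along (eta i) (x, u) (x, u + s *\<^sub>R axis (H m n) 1)"
  unfolding inv_along_def shift_hv[symmetric]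
  using segment_transport[OF _ snd_hv_L xi_hv assms(1)] segment_transport[OF _ snd_hv_L eta_hv assms(1)]
    differentiable_xi differentiable_eta assms(2) by blast+

lemma ev_phi:
  assumes "(x, u) \<in> N" "i \<noteq> j" "j \<noteq> k" "i \<noteq> k" "m \<noteq> n" "m = k \<or> n = k"
  shows "\<forall>\<^sub>F s in nhds (0::real). inv_along (phi i j) (x, u) (x, u + s *\<^sub>R axis (H m n) 1)"
  unfolding inv_along_def shift_hv[symmetric]
  using segment_transport(1)[OF _ snd_hv_L phi_hv[OF _ assms(2-6)] assms(1)] differentiable_phi by blast

lemma nonzero_L: "(x, u) \<in> N \<Longrightarrow> u $ L i \<noteq> 0"
  using nonzero_M by blast

section \<open>Splitting of the equations for xi\<close>

lemma xi_equation:
  assumes z: "(x, u) \<in> N" and d: "i \<noteq> j" "j \<noteq> k" "i \<noteq> k"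
  shows "dd (xi i) (x, u) (xv k) + u $ H i k * dd (xi i) (x, u) (rot u i k)
    + u $ H j k * dd (xi i) (x, u) (rot u j k) = 0"
proof -
  obtain w where w: "lame_jet u w" using lame_jet_exists by blast
  have h: "dd (xi r) (x, u) (hv m n) = 0" if "m \<noteq> n" for r m n using xi_hv[OF z that] .
  show ?thesis
    using xi_jdir[OF z w d(3)] d unfolding jdir_decomp(1)[OF d w nonzero_L[OF z]]
    by (simp add: dd_components_linear[OF z] h)
qed

text \<open>\<open>xi_equation\<close> is affine in \<open>h_ik\<close> and \<open>h_jk\<close>,
  with coefficients that a shift of \<open>h\<close> does not change. Shifting one entry by
  \<open>s\<close> and subtracting isolates its coefficient.\<close>

lemma xi_off_diag:
  assumes z: "(x, u) \<in> N" and d: "i \<noteq> j" "j \<noteq> k" "i \<noteq> k"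
  shows "dd (xi i) (x, u) (xv k) = 0" "dd (xi i) (x, u) (rot u i k) = 0" "dd (xi i) (x, u) (rot u j k) = 0"
proof -
  have *: "dd (xi i) (x, u) (rot u m k) = 0" if m: "m = i \<or> m = j" for m
  proof -
    have mk: "m \<noteq> k" using d m by auto
    obtain s where s: "s \<noteq> 0" "(x, u + s *\<^sub>R axis (H m k) 1) \<in> N"
        "inv_along (xi i) (x, u) (x, u + s *\<^sub>R axis (H m k) 1)"
      using eventually_nhds_0_nonzero[OF eventually_conj[OF ev_N[OF z mk] ev_xi[OF z mk, of i]]] by blast
    have h: "(u + s *\<^sub>R axis (H m k) 1) $ H i k = u $ H i k + (if m = i then s else 0)"
      "(u + s *\<^sub>R axis (H m k) 1) $ H j k = u $ H j k + (if m = j then s else 0)"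
      using d mk by (auto simp: shift_simps)
    have e: "dd (xi i) (x, u) (xv k) + (u $ H i k + (if m = i then s else 0)) * dd (xi i) (x, u) (rot u i k)
      + (u $ H j k + (if m = j then s else 0)) * dd (xi i) (x, u) (rot u j k) = 0"
      using xi_equation[OF s(2) d] unfolding h inv_along_dest(2)[OF s(3)] shift_nth(3) inv_along_dest(3)[OF s(3)] .
    from m have "s * dd (xi i) (x, u) (rot u m k) = 0"
    proof
      assume "m = i"
      then have "dd (xi i) (x, u) (xv k) + (u $ H i k + s) * dd (xi i) (x, u) (rot u m k)
        + u $ H j k * dd (xi i) (x, u) (rot u j k) = 0" using e d(1) by simp
      then show ?thesis using xi_equation[OF z d] unfolding \<open>m = i\<close> distrib_right by linarith
    next
      assume "m = j"
      then have "dd (xi i) (x, u) (xv k) + u $ H i k * dd (xi i) (x, u) (rot u i k)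
        + (u $ H j k + s) * dd (xi i) (x, u) (rot u m k) = 0" using e d(1) by simp
      then show ?thesis using xi_equation[OF z d] unfolding \<open>m = j\<close> distrib_right by linarith
    qed
    then show ?thesis using s by simp
  qed
  then show r: "dd (xi i) (x, u) (rot u i k) = 0" "dd (xi i) (x, u) (rot u j k) = 0" by auto
  show "dd (xi i) (x, u) (xv k) = 0" using xi_equation[OF z d] r by simp
qed

lemma xi_xv: "(x, u) \<in> N \<Longrightarrow> i \<noteq> k \<Longrightarrow> dd (xi i) (x, u) (xv k) = 0"
  by (rule third_index[of i k]) (metis xi_off_diag(1))

text \<open>\<open>xi_off_diag\<close> covers the rotations whose second index is not
  \<open>i\<close>; the remaining ones are multiples of these by \<open>rot_swap\<close>.\<close>

lemma xi_rot:
  assumes z: "(x, u) \<in> N" and mn: "m \<noteq> n"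
  shows "dd (xi i) (x, u) (rot u m n) = 0"
proof -
  have *: "dd (xi i) (x, u) (rot u m n) = 0" if mn: "m \<noteq> n" and "n \<noteq> i" for m n
  proof -
    obtain j where j: "j \<noteq> i" "j \<noteq> n" by (rule third_index)
    have d: "i \<noteq> j" "j \<noteq> n" "i \<noteq> n" using j that by auto
    note x = xi_off_diag(2,3)[OF z d]
    show ?thesis by (rule cases_3_distinct[OF d, of m]) (use x mn in blast)+
  qed
  show ?thesis
  proof (cases "n = i")
    case True
    then have 0: "dd (xi i) (x, u) (rot u n m) = 0" using *[of n m] mn by blast
    have "dd (xi i) (x, u) (rot u m n) = - (eps n * eps m) * dd (xi i) (x, u) (rot u n m)"
      unfolding rot_swap[of u m n] by (rule dd_components_linear(2)[OF z])
    then show ?thesis using 0 by simp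
  qed (use * mn in blast)
qed

text \<open>The value no longer depends on the jet, and each correction sum in the prolongation
  reduces to a single term.\<close>

lemma xi_jdir_diag:
  assumes z: "(x, u) \<in> N" and w: "lame_jet u w"
  shows "dd (xi r) (x, u) (jdir w k) = (if r = k then dd (xi k) (x, u) (xv k) else 0)"
proof -
  obtain i where i: "i \<noteq> k" "i \<noteq> k" by (rule third_index)
  obtain j where j: "j \<noteq> k" "j \<noteq> i" by (rule third_index)
  have d: "i \<noteq> j" "j \<noteq> k" "i \<noteq> k" using i j by auto
  have h: "dd (xi r) (x, u) (hv m n) = 0" if "m \<noteq> n" for r m n using xi_hv[OF z that] .
  show ?thesis
    using xi_jdir[OF z w] d unfolding jdir_decomp(1)[OF d w nonzero_L[OF z]]
    by (simp add: dd_components_linear[OF z] h xi_rot[OF z] xi_xv[OF z])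
qed

section \<open>The equations for eta and the shape of phi\<close>

lemma eta_equation:
  assumes z: "(x, u) \<in> N" and d: "i \<noteq> j" "j \<noteq> k" "i \<noteq> k"
  shows "dd (eta i) (x, u) (xv j) + u $ H i j * dd (eta i) (x, u) (rot u i j)
    + u $ H k j * dd (eta i) (x, u) (rot u k j) - dd (xi j) (x, u) (xv j) * (u $ H i j * u $ L j)
    = phi i j (x, u) * u $ L j + u $ H i j * eta j (x, u)"
proof -
  obtain w where w: "lame_jet u w" using lame_jet_exists by blast
  have d': "i \<noteq> k" "k \<noteq> j" "i \<noteq> j" using d by auto
  have h: "dd (eta r) (x, u) (hv m n) = 0" if "m \<noteq> n" for r m n using eta_hv[OF z that] .
  have "dd (eta i) (x, u) (jdir w j) = dd (eta i) (x, u) (xv j) + u $ H i j * dd (eta i) (x, u) (rot u i j)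
    + u $ H k j * dd (eta i) (x, u) (rot u k j)"
    using d unfolding jdir_decomp(1)[OF d' w nonzero_L[OF z]] by (simp add: dd_components_linear[OF z] h)
  moreover have "w $ L i $ j = u $ H i j * u $ L j" using w d unfolding lame_jet_def by blast
  ultimately show ?thesis
    using pr_eqs'(2)[OF z w d] d by (simp add: sum_3_distinct[OF d] xi_jdir_diag[OF z w])
qed

text \<open>In \<open>eta_equation\<close> the entry \<open>h_kj\<close> occurs explicitly only as
  factor of this derivative. All other terms, \<open>phi i j\<close> included, are invariant under
  its shift, so a finite difference isolates it.\<close>

lemma eta_rot_off_diag:
  assumes z: "(x, u) \<in> N" and d: "i \<noteq> j" "j \<noteq> k" "i \<noteq> k"
  shows "dd (eta i) (x, u) (rot u k j) = 0"
proof -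
  have kj: "k \<noteq> j" using d by auto
  obtain s where s: "s \<noteq> 0" "(x, u + s *\<^sub>R axis (H k j) 1) \<in> N"
      "inv_along (xi j) (x, u) (x, u + s *\<^sub>R axis (H k j) 1)"
      "inv_along (eta i) (x, u) (x, u + s *\<^sub>R axis (H k j) 1)"
      "inv_along (eta j) (x, u) (x, u + s *\<^sub>R axis (H k j) 1)"
      "inv_along (phi i j) (x, u) (x, u + s *\<^sub>R axis (H k j) 1)"
    using eventually_nhds_0_nonzero[OF eventually_conj[OF ev_N[OF z kj] eventually_conj[OF ev_xi[OF z kj, of j]
       eventually_conj[OF ev_eta[OF z kj, of i] eventually_conj[OF ev_eta[OF z kj, of j]
       ev_phi[OF z d kj]]]]]] by blast
  have h: "(u + s *\<^sub>R axis (H k j) 1) $ H k j = u $ H k j + s" "(u + s *\<^sub>R axis (H k j) 1) $ H i j = u $ H i j"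
    using d kj by (simp_all add: shift_simps)
  have "dd (eta i) (x, u) (xv j) + u $ H i j * dd (eta i) (x, u) (rot u i j)
    + (u $ H k j + s) * dd (eta i) (x, u) (rot u k j) - dd (xi j) (x, u) (xv j) * (u $ H i j * u $ L j)
    = phi i j (x, u) * u $ L j + u $ H i j * eta j (x, u)"
    using eta_equation[OF s(2) d] unfolding h shift_nth(1,3) inv_along_dest(2)[OF s(3)]
      inv_along_dest(2,3)[OF s(4)] inv_along_dest(1)[OF s(5)] inv_along_dest(1)[OF s(6)] .
  with eta_equation[OF z d] have "s * dd (eta i) (x, u) (rot u k j) = 0"
    unfolding distrib_right by linarith
  then show ?thesis using s by simp
qed

text \<open>\<open>phi_const\<close> and \<open>phi_slope\<close> are the coefficients in the affine
  dependence of \<open>phi i j\<close> on \<open>h_ij\<close>, obtained by dividing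
  \<open>eta_equation\<close> by \<open>l_j\<close>.\<close>

definition phi_const :: "3 \<Rightarrow> 3 \<Rightarrow> (3, dep) pt \<Rightarrow> real" where
  "phi_const i j z = dd (eta i) z (xv j) / snd z $ L j"

definition phi_slope :: "3 \<Rightarrow> 3 \<Rightarrow> (3, dep) pt \<Rightarrow> real" where
  "phi_slope i j z = dd (eta i) z (rot (snd z) i j) / snd z $ L j - eta j z / snd z $ L j - dd (xi j) z (xv j)"

lemma phi_eq:
  assumes z: "(x, u) \<in> N" and ij: "i \<noteq> j"
  shows "phi i j (x, u) = phi_const i j (x, u) + u $ H i j * phi_slope i j (x, u)"
proof -
  obtain k where k: "k \<noteq> i" "k \<noteq> j" by (rule third_index)
  have d: "i \<noteq> j" "j \<noteq> k" "i \<noteq> k" using k ij by auto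
  have phi_const: "phi_const i j (x, u) * u $ L j = dd (eta i) (x, u) (xv j)"
    using nonzero_L[OF z, of j] by (simp add: phi_const_def)
  have phi_slope: "phi_slope i j (x, u) * u $ L j = dd (eta i) (x, u) (rot u i j) - eta j (x, u) - dd (xi j) (x, u) (xv j) * u $ L j"
    using nonzero_L[OF z, of j] by (simp add: phi_slope_def left_diff_distrib)
  have "(phi_const i j (x, u) + u $ H i j * phi_slope i j (x, u)) * u $ L j
      = phi_const i j (x, u) * u $ L j + u $ H i j * (phi_slope i j (x, u) * u $ L j)"
    by (simp only: distrib_right mult.assoc)
  also have "\<dots> = phi i j (x, u) * u $ L j"
    unfolding phi_const phi_slope using eta_equation[OF z d] eta_rot_off_diag[OF z d]
    by (simp add: right_diff_distrib mult.left_commute)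
  finally have "phi i j (x, u) * u $ L j = (phi_const i j (x, u) + u $ H i j * phi_slope i j (x, u)) * u $ L j" ..
  then show ?thesis using nonzero_L[OF z, of j] by simp
qed

lemma
  assumes z: "(x, u) \<in> N" and mn: "m \<noteq> n"
  shows ev_phi_const: "\<forall>\<^sub>F s in nhds (0::real). phi_const i j (x, u + s *\<^sub>R axis (H m n) 1) = phi_const i j (x, u)"
    and ev_phi_slope: "\<forall>\<^sub>F s in nhds (0::real). phi_slope i j (x, u + s *\<^sub>R axis (H m n) 1) = phi_slope i j (x, u)"
proof -
  show "\<forall>\<^sub>F s in nhds (0::real). phi_const i j (x, u + s *\<^sub>R axis (H m n) 1) = phi_const i j (x, u)"
    using ev_eta[OF z mn, of i] by eventually_elim (simp add: phi_const_def inv_along_dest shift_simps)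
  show "\<forall>\<^sub>F s in nhds (0::real). phi_slope i j (x, u + s *\<^sub>R axis (H m n) 1) = phi_slope i j (x, u)"
    using ev_eta[OF z mn, of i] ev_eta[OF z mn, of j] ev_xi[OF z mn, of j]
    by eventually_elim (simp add: phi_slope_def inv_along_dest shift_simps)
qed

text \<open>The formula \<open>phi_eq\<close> is valid on \<open>N\<close> only, but short lines in
  the direction of an entry of \<open>h\<close> stay in \<open>N\<close>, and both coefficients are
  constant on them.\<close>

lemma phi_hv_diag:
  assumes z: "(x, u) \<in> N" and ij: "i \<noteq> j"
  shows "dd (phi i j) (x, u) (hv i j) = phi_slope i j (x, u)" "dd (phi i j) (x, u) (hv j i) = 0"
proof -
  have diff: "phi i j differentiable (at (x, u))" using z differentiable_phi by blast
  have *: "dd (phi i j) (x, u) (hv m n) = (if m = i \<and> n = j then phi_slope i j (x, u) else 0)" if mn: "m \<noteq> n" for m n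
  proof -
    let ?c = "if m = i \<and> n = j then phi_slope i j (x, u) else 0"
    \<comment> \<open>The direction 0 on the right makes the second function constant in
      \<open>s\<close>, so \<open>dd_line\<close> returns just the slope \<open>?c\<close>.\<close>
    have "\<forall>\<^sub>F s in nhds (0::real). phi i j ((x, u) + s *\<^sub>R hv m n) = phi i j ((x, u) + s *\<^sub>R 0) + ?c * s"
      using ev_N[OF z mn] ev_phi_const[OF z mn, of i j] ev_phi_slope[OF z mn, of i j]
    proof eventually_elim
      case (elim s)
      then show ?case using ij mn
        by (simp add: shift_hv phi_eq[OF elim(1) ij] phi_eq[OF z ij] shift_simps algebra_simps)
    qed
    from dd_line[OF diff diff this] show ?thesis by (simp add: dd_components_linear[OF z])
  qed
  show "dd (phi i j) (x, u) (hv i j) = phi_slope i j (x, u)" "dd (phi i j) (x, u) (hv j i) = 0"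
    using *[of i j] *[of j i] ij by auto
qed

section \<open>Splitting of the equations for phi\<close>

lemma phi_equation:
  assumes z: "(x, u) \<in> N" and d: "i \<noteq> j" "j \<noteq> k" "i \<noteq> k"
  shows "dd (phi i j) (x, u) (xv k) + u $ H i k * dd (phi i j) (x, u) (rot u i k)
    + u $ H j k * dd (phi i j) (x, u) (rot u j k)
    + (phi_slope i j (x, u) - dd (xi k) (x, u) (xv k)) * (u $ H i k * u $ H k j)
    = phi i k (x, u) * u $ H k j + u $ H i k * phi k j (x, u)"
proof -
  obtain w where w: "lame_jet u w" using lame_jet_exists by blast
  have "dd (phi i j) (x, u) (jdir w k) = dd (phi i j) (x, u) (xv k) + u $ H i k * dd (phi i j) (x, u) (rot u i k)
    + u $ H j k * dd (phi i j) (x, u) (rot u j k) + phi_slope i j (x, u) * (u $ H i k * u $ H k j)"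
    using d unfolding jdir_decomp(1)[OF d w nonzero_L[OF z]]
    by (simp add: dd_components_linear[OF z] phi_hv_diag[OF z] phi_hv[OF z d])
  moreover have "w $ H i j $ k = u $ H i k * u $ H k j" using w d unfolding lame_jet_def by blast
  ultimately show ?thesis
    using pr_eqs'(4)[OF z w d] d by (simp add: sum_3_distinct[OF d] xi_jdir_diag[OF z w] algebra_simps)
qed

text \<open>A finite difference of \<open>phi_equation\<close> in \<open>h_kj\<close>: the left side
  depends on it through one product only, as \<open>phi i j\<close> is invariant, and the right side
  is expanded by \<open>phi_eq\<close>.\<close>

lemma phi_equation':
  assumes z: "(x, u) \<in> N" and d: "i \<noteq> j" "j \<noteq> k" "i \<noteq> k"
  shows "u $ H i k * (phi_slope i j (x, u) - dd (xi k) (x, u) (xv k) - phi_slope i k (x, u) - phi_slope k j (x, u)) = phi_const i k (x, u)"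
proof -
  have kj: "k \<noteq> j" using d by auto
  let ?u = "\<lambda>s. u + s *\<^sub>R axis (H k j) 1"
  obtain s where s: "s \<noteq> 0" and N: "(x, ?u s) \<in> N"
    and inv: "inv_along (xi k) (x, u) (x, ?u s)" "inv_along (phi i j) (x, u) (x, ?u s)"
    and phi_const: "phi_const i k (x, ?u s) = phi_const i k (x, u)" "phi_const k j (x, ?u s) = phi_const k j (x, u)"
    and phi_slope: "phi_slope i j (x, ?u s) = phi_slope i j (x, u)" "phi_slope i k (x, ?u s) = phi_slope i k (x, u)" "phi_slope k j (x, ?u s) = phi_slope k j (x, u)"
    using eventually_nhds_0_nonzero[OF eventually_conj[OF ev_N[OF z kj] eventually_conj[OF ev_xi[OF z kj, of k]
       eventually_conj[OF ev_phi[OF z d kj] eventually_conj[OF ev_phi_const[OF z kj, of i k] eventually_conj[OF ev_phi_const[OF z kj, of k j]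
       eventually_conj[OF ev_phi_slope[OF z kj, of i j] eventually_conj[OF ev_phi_slope[OF z kj, of i k] ev_phi_slope[OF z kj, of k j]]]]]]]]]
    by blast
  have h: "?u s $ H k j = u $ H k j + s" "?u s $ H i k = u $ H i k" "?u s $ H j k = u $ H j k"
    using d d[symmetric] by (simp_all add: shift_simps)
  note r = phi_eq[OF z d(3)] phi_eq[OF z kj] phi_eq[OF N d(3)] phi_eq[OF N kj]
  \<comment> \<open>Here \<open>g\<close> and \<open>a\<close> are \<open>h_kj\<close> and
    \<open>h_ik\<close>, \<open>t\<close> is the shift, \<open>b\<close>, \<open>q\<close>,
    \<open>r\<close> are slopes, \<open>c\<close>, \<open>e\<close> the constant coefficients,
    \<open>p\<close> is the derivative of \<open>xi k\<close>, and \<open>E\<close> collects what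
    the shift leaves alone.\<close>
  have aux: "t * (a * (b - p - q - r)) = t * c"
    if "E + (b - p) * (a * g) = (c + a * q) * g + a * (e + g * r)"
      "E + (b - p) * (a * (g + t)) = (c + a * q) * (g + t) + a * (e + (g + t) * r)"
    for E a b c e g p q r t :: real
    using that by algebra
  have "s * (u $ H i k * (phi_slope i j (x, u) - dd (xi k) (x, u) (xv k) - phi_slope i k (x, u) - phi_slope k j (x, u)))
     = s * phi_const i k (x, u)"
    by (rule aux[OF phi_equation[OF z d, unfolded r] phi_equation[OF N d, unfolded r phi_const phi_slope h shift_nth(3)
      inv_along_dest(2)[OF inv(1)] inv_along_dest(2,3)[OF inv(2)]]])
  then show ?thesis using s by simp
qed

text \<open>A second finite difference, now of \<open>phi_equation'\<close> in \<open>h_ik\<close>: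
  the bracket \<open>B\<close> and the right side are invariant, so \<open>B\<close> vanishes and
  the right side with it.\<close>

lemma phi_slope_cocycle:
  assumes z: "(x, u) \<in> N" and d: "i \<noteq> j" "j \<noteq> k" "i \<noteq> k"
  shows "phi_slope i j (x, u) = dd (xi k) (x, u) (xv k) + phi_slope i k (x, u) + phi_slope k j (x, u)"
    and "phi_const i k (x, u) = 0"
proof -
  let ?u = "\<lambda>s. u + s *\<^sub>R axis (H i k) 1"
  obtain s where s: "s \<noteq> 0" and N: "(x, ?u s) \<in> N"
    and inv: "inv_along (xi k) (x, u) (x, ?u s)"
    and phi_const: "phi_const i k (x, ?u s) = phi_const i k (x, u)"
    and phi_slope: "phi_slope i j (x, ?u s) = phi_slope i j (x, u)" "phi_slope i k (x, ?u s) = phi_slope i k (x, u)" "phi_slope k j (x, ?u s) = phi_slope k j (x, u)"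
    using eventually_nhds_0_nonzero[OF eventually_conj[OF ev_N[OF z d(3)] eventually_conj[OF ev_xi[OF z d(3), of k]
       eventually_conj[OF ev_phi_const[OF z d(3), of i k]
       eventually_conj[OF ev_phi_slope[OF z d(3), of i j] eventually_conj[OF ev_phi_slope[OF z d(3), of i k] ev_phi_slope[OF z d(3), of k j]]]]]]]
    by blast
  have h: "?u s $ H i k = u $ H i k + s" using d by (simp add: shift_simps)
  define B where "B = phi_slope i j (x, u) - dd (xi k) (x, u) (xv k) - phi_slope i k (x, u) - phi_slope k j (x, u)"
  have 1: "u $ H i k * B = phi_const i k (x, u)" using phi_equation'[OF z d] by (simp add: B_def)
  have "(u $ H i k + s) * B = phi_const i k (x, u)"
    using phi_equation'[OF N d] by (simp only: B_def h phi_const phi_slope inv_along_dest(2)[OF inv])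
  then have "s * B = 0" using 1 by (simp add: distrib_right del: mult_eq_0_iff)
  then have "B = 0" using s by simp
  then show "phi_slope i j (x, u) = dd (xi k) (x, u) (xv k) + phi_slope i k (x, u) + phi_slope k j (x, u)" "phi_const i k (x, u) = 0"
    using 1 by (simp_all add: B_def)
qed

lemma phi_const_zero: "(x, u) \<in> N \<Longrightarrow> i \<noteq> k \<Longrightarrow> phi_const i k (x, u) = 0"
  by (rule third_index[of i k]) (metis phi_slope_cocycle(2))

lemma eta_xv_off_diag: "(x, u) \<in> N \<Longrightarrow> i \<noteq> k \<Longrightarrow> dd (eta i) (x, u) (xv k) = 0"
  using phi_const_zero[of x u i k] nonzero_L[of x u k] by (simp add: phi_const_def)

text \<open>With the definition of \<open>phi_slope\<close> inserted, the derivatives of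
  \<open>xi\<close> cancel in the cocycle relation. The two terms from \<open>eta i\<close> agree as
  well, which leaves the derivative of \<open>eta k\<close>.\<close>

lemma eta_rot_diag:
  assumes z: "(x, u) \<in> N" and kj: "k \<noteq> j"
  shows "dd (eta k) (x, u) (rot u k j) = eta k (x, u) / u $ L k * u $ L j"
proof -
  obtain i where i: "i \<noteq> k" "i \<noteq> j" by (rule third_index)
  have d: "i \<noteq> j" "j \<noteq> k" "i \<noteq> k" using i kj by auto
  have d': "i \<noteq> k" "k \<noteq> j" "i \<noteq> j" using d by auto
  define a b c where "a = dd (eta i) (x, u) (rot u i j)" and "b = dd (eta i) (x, u) (rot u i k)"
    and "c = dd (eta k) (x, u) (rot u k j)"
  \<comment> \<open>The linear relation between the three rotations; its last term does not
    contribute by \<open>eta_rot_off_diag\<close>.\<close>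
  have "u $ L k *\<^sub>R rot u i j = u $ L j *\<^sub>R rot u i k + (- (eps i * eps j * u $ L i)) *\<^sub>R rot u j k"
    by (simp add: rot_def algebra_simps)
  then have "dd (eta i) (x, u) (u $ L k *\<^sub>R rot u i j)
      = dd (eta i) (x, u) (u $ L j *\<^sub>R rot u i k + (- (eps i * eps j * u $ L i)) *\<^sub>R rot u j k)" by (rule arg_cong)
  then have "u $ L k * a = u $ L j * b"
    unfolding dd_components_linear(5,6)[OF z] eta_rot_off_diag[OF z d'] a_def b_def by simp
  then have ab: "a / u $ L j = b / u $ L k"
    using nonzero_L[OF z, of j] nonzero_L[OF z, of k] by (simp add: frac_eq_eq mult.commute)
  have "a / u $ L j - eta j (x, u) / u $ L j - dd (xi j) (x, u) (xv j) = dd (xi k) (x, u) (xv k)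
     + (b / u $ L k - eta k (x, u) / u $ L k - dd (xi k) (x, u) (xv k))
     + (c / u $ L j - eta j (x, u) / u $ L j - dd (xi j) (x, u) (xv j))"
    using phi_slope_cocycle(1)[OF z d] unfolding phi_slope_def snd_conv a_def b_def c_def .
  then have c: "c / u $ L j = eta k (x, u) / u $ L k" using ab by linarith
  have "c = c / u $ L j * u $ L j" using nonzero_L[OF z, of j] by simp
  then show ?thesis unfolding c by (simp only: c_def)
qed

section \<open>Proportionality of eta and l\<close>

definition eta_ratio :: "3 \<Rightarrow> (3, dep) pt \<Rightarrow> real" where "eta_ratio i z = eta i z / snd z $ L i"

lemma phi_slope_eq:
  assumes z: "(x, u) \<in> N" and ij: "i \<noteq> j"
  shows "phi_slope i j (x, u) = eta_ratio i (x, u) - eta_ratio j (x, u) - dd (xi j) (x, u) (xv j)"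
  using eta_rot_diag[OF z ij] nonzero_L[OF z, of j] by (simp add: phi_slope_def eta_ratio_def)

lemma ev_eta_ratio:
  assumes "(x, u) \<in> N" "m \<noteq> n"
  shows "\<forall>\<^sub>F s in nhds (0::real). eta_ratio i (x, u + s *\<^sub>R axis (H m n) 1) = eta_ratio i (x, u)"
  using ev_eta[OF assms, of i] by eventually_elim (simp add: eta_ratio_def inv_along_dest shift_simps)

text \<open>The prolonged diagonal equation for \<open>l_i\<close> with the known forms of
  \<open>phi\<close> and of the derivatives of \<open>eta\<close>. The derivative of
  \<open>xi i\<close> cancels through the equation itself, and each difference of ratios arises
  twice.\<close>

lemma eta_ratio_equation:
  assumes z: "(x, u) \<in> N" and d: "i \<noteq> j" "j \<noteq> k" "i \<noteq> k"
  shows "eps i * dd (eta i) (x, u) (xv i)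
     + 2 * (eps j * u $ H j i * u $ L j * (eta_ratio j (x, u) - eta_ratio i (x, u)))
     + 2 * (eps k * u $ H k i * u $ L k * (eta_ratio k (x, u) - eta_ratio i (x, u))) = 0"
proof -
  obtain w where w: "lame_jet u w" using lame_jet_exists by blast
  have d': "j \<noteq> k" "k \<noteq> i" "j \<noteq> i" using d by auto
  have h: "dd (eta r) (x, u) (hv m n) = 0" if "m \<noteq> n" for r m n using eta_hv[OF z that] .
  have e: "eta m (x, u) = eta_ratio m (x, u) * u $ L m" for m using nonzero_L[OF z, of m] by (simp add: eta_ratio_def)
  have r: "dd (eta i) (x, u) (rot u m i) = - (eps i * eps m) * (eta_ratio i (x, u) * u $ L m)" if "m \<noteq> i" for m
    using eta_rot_diag[OF z that[symmetric]] dd_components_linear(6)[OF z, of i "- (eps i * eps m)" "rot u i m"]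
    unfolding rot_swap[of u m i] eta_ratio_def by simp
  have p: "phi m i (x, u) = u $ H m i * (eta_ratio m (x, u) - eta_ratio i (x, u) - dd (xi i) (x, u) (xv i))" if "m \<noteq> i" for m
    unfolding phi_eq[OF z that] phi_const_zero[OF z that] phi_slope_eq[OF z that] by simp
  have J: "dd (eta i) (x, u) (jdir w i) = dd (eta i) (x, u) (xv i) + u $ H j i * dd (eta i) (x, u) (rot u j i)
    + u $ H k i * dd (eta i) (x, u) (rot u k i)"
    using d d[symmetric] unfolding jdir_decomp(1)[OF d' w nonzero_L[OF z]] by (simp add: dd_components_linear[OF z] h)
  have W: "eps i * w $ L i $ i = - (eps j * u $ H j i * u $ L j + eps k * u $ H k i * u $ L k)"
    using w[unfolded lame_jet_def, rule_format, of i j k] d by linarith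
  have S: "(\<Sum>r\<in>UNIV. dd (xi r) (x, u) (jdir w i) * w $ L i $ r) = dd (xi i) (x, u) (xv i) * w $ L i $ i"
    using d d[symmetric] by (simp add: sum_3_distinct[OF d] xi_jdir_diag[OF z w])
  \<comment> \<open>\<open>X\<close> is the derivative of \<open>eta i\<close> by
    \<open>x_i\<close>, \<open>W\<close> that of \<open>l_i\<close>, \<open>p\<close> that of
    \<open>xi i\<close>; \<open>a\<close>, \<open>b\<close> are \<open>h_ji\<close>,
    \<open>h_ki\<close>, and \<open>l\<close>, \<open>m\<close> are \<open>l_j\<close>,
    \<open>l_k\<close>.\<close>
  have aux: "ei * X + 2 * (ej * a * l * (cj - ci)) + 2 * (ek * b * m * (ck - ci)) = 0"
    if "ei * (X + a * (- (ei * ej) * (ci * l)) + b * (- (ei * ek) * (ci * m)) - p * W)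
        + ej * (a * (cj - ci - p) * l + a * (cj * l)) + ek * (b * (ck - ci - p) * m + b * (ck * m)) = 0"
      "ei * W = - (ej * a * l + ek * b * m)" "ei * ei = 1"
    for ei ej ek X a b l m ci cj ck p W :: real
    using that by algebra
  show ?thesis
    by (rule aux[OF pr_eqs'(3)[OF z w d, unfolded J S r[OF d(1)[symmetric]] r[OF d(3)[symmetric]]
        p[OF d(1)[symmetric]] p[OF d(3)[symmetric]] e] W eps_sq(1)])
qed

text \<open>The difference of the ratios is, up to nonzero factors, the coefficient of
  \<open>h_ji\<close> in \<open>eta_ratio_equation\<close>, so shifting this entry makes it
  vanish.\<close>

lemma eta_ratio_eq_distinct:
  assumes z: "(x, u) \<in> N" and d: "i \<noteq> j" "j \<noteq> k" "i \<noteq> k"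
  shows "eta_ratio j (x, u) = eta_ratio i (x, u)"
proof -
  have ji: "j \<noteq> i" using d by auto
  let ?u = "\<lambda>s. u + s *\<^sub>R axis (H j i) 1"
  obtain s where s: "s \<noteq> 0" and N: "(x, ?u s) \<in> N" and inv: "inv_along (eta i) (x, u) (x, ?u s)"
    and eta_ratio: "eta_ratio i (x, ?u s) = eta_ratio i (x, u)" "eta_ratio j (x, ?u s) = eta_ratio j (x, u)" "eta_ratio k (x, ?u s) = eta_ratio k (x, u)"
    using eventually_nhds_0_nonzero[OF eventually_conj[OF ev_N[OF z ji] eventually_conj[OF ev_eta[OF z ji, of i]
       eventually_conj[OF ev_eta_ratio[OF z ji, of i] eventually_conj[OF ev_eta_ratio[OF z ji, of j] ev_eta_ratio[OF z ji, of k]]]]]]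
    by blast
  have h: "?u s $ H j i = u $ H j i + s" "?u s $ H k i = u $ H k i"
    using d d[symmetric] by (simp_all add: shift_simps)
  have aux: "e * t * l * c = 0"
    if "X + 2 * (e * a * l * c) + Y = 0" "X + 2 * (e * (a + t) * l * c) + Y = 0"
    for X Y e a l c t :: real
    using that by algebra
  have "eps j * s * u $ L j * (eta_ratio j (x, u) - eta_ratio i (x, u)) = 0"
    by (rule aux[OF eta_ratio_equation[OF z d] eta_ratio_equation[OF N d, unfolded eta_ratio h shift_nth(1) inv_along_dest(2)[OF inv]]])
  then show ?thesis using s nonzero_L[OF z, of j] by simp
qed

lemma eta_ratio_eq: "(x, u) \<in> N \<Longrightarrow> eta_ratio j (x, u) = eta_ratio i (x, u)"
  by (cases "i = j", simp, rule third_index[of i j]) (metis eta_ratio_eq_distinct)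

text \<open>Off the diagonal this is the vanishing of \<open>phi_const\<close>; on the diagonal it
  is what \<open>eta_ratio_equation\<close> leaves once all ratios agree.\<close>

lemma eta_xv:
  assumes z: "(x, u) \<in> N"
  shows "dd (eta i) (x, u) (xv k) = 0"
proof (cases "i = k")
  case True
  obtain j where j: "j \<noteq> i" by (rule third_index)
  obtain k where k: "k \<noteq> i" "k \<noteq> j" by (rule third_index)
  have d: "i \<noteq> j" "j \<noteq> k" "i \<noteq> k" using j k by auto
  show ?thesis using eta_ratio_equation[OF z d] eta_ratio_eq[OF z, of j i] eta_ratio_eq[OF z, of k i] True by simp
qed (use eta_xv_off_diag[OF z] in blast)

text \<open>In the basis of \<open>tang_decomp\<close> only the rotation that moves
  \<open>L k\<close> contributes. The formula makes the quotient \<open>eta_ratio\<close> stationary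
  along the cone.\<close>

lemma eta_deriv:
  assumes z: "(x, u) \<in> N" and t: "tang (x, u) v"
  shows "dd (eta k) (x, u) v = eta_ratio k (x, u) * snd v $ L k"
proof -
  obtain j where j: "j \<noteq> k" by (rule third_index)
  obtain i where i: "i \<noteq> k" "i \<noteq> j" by (rule third_index)
  have d: "i \<noteq> k" "k \<noteq> j" "i \<noteq> j" using i j by auto
  have h: "dd (eta r) (x, u) (hv m n) = 0" if "m \<noteq> n" for r m n using eta_hv[OF z that] .
  have d': "k \<noteq> i" "i \<noteq> j" "k \<noteq> j" using d by auto
  have "dd (eta k) (x, u) (rot u i j) = 0" using eta_rot_off_diag[OF z, of k j i] d d[symmetric] by blast
  moreover have "dd (eta k) (x, u) (rot u k j) = eta_ratio k (x, u) * u $ L j"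
    using eta_rot_diag[OF z d(2)] by (simp add: eta_ratio_def)
  ultimately show ?thesis using d d[symmetric] nonzero_L[OF z, of j]
    by (subst tang_decomp[OF d t nonzero_L[OF z]]) (simp add: dd_components_linear[OF z] h eta_xv[OF z])
qed

lemma xi_deriv:
  assumes z: "(x, u) \<in> N" and t: "tang (x, u) v"
  shows "dd (xi i) (x, u) v = dd (xi i) (x, u) (xv i) * fst v $ i"
proof -
  obtain j where j: "j \<noteq> i" by (rule third_index)
  obtain k where k: "k \<noteq> i" "k \<noteq> j" by (rule third_index)
  have d: "i \<noteq> j" "j \<noteq> k" "i \<noteq> k" using j k by auto
  have h: "dd (xi r) (x, u) (hv m n) = 0" if "m \<noteq> n" for r m n using xi_hv[OF z that] .
  show ?thesis using d d[symmetric]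
    by (subst tang_decomp[OF d t nonzero_L[OF z]]) (simp add: dd_components_linear[OF z] h xi_xv[OF z] xi_rot[OF z])
qed

lemma phi_diag:
  assumes z: "(x, u) \<in> N" and ij: "i \<noteq> j"
  shows "phi_slope i j (x, u) = - dd (xi j) (x, u) (xv j)"
    and "phi i j (x, u) = - dd (xi j) (x, u) (xv j) * u $ H i j"
  using phi_eq[OF z ij] phi_const_zero[OF z ij] phi_slope_eq[OF z ij] eta_ratio_eq[OF z, of i j] by simp_all

text \<open>The prolonged equation for the derivative of \<open>h_ij\<close> by \<open>x_j\<close>
  plus that of \<open>h_ji\<close> by \<open>x_i\<close> is compared on two jets differing by
  \<open>free_jet_last i j\<close>. Slope and correction term each contribute one derivative of
  \<open>xi\<close>, with opposite signs for the two indices.\<close>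

lemma xi_xv_eq_distinct:
  assumes z: "(x, u) \<in> N" and ij: "i \<noteq> j"
  shows "dd (xi i) (x, u) (xv i) = dd (xi j) (x, u) (xv j)"
proof -
  obtain k where k: "k \<noteq> i" "k \<noteq> j" by (rule third_index)
  have d: "i \<noteq> j" "j \<noteq> k" "i \<noteq> k" using k ij by auto
  obtain w where w: "lame_jet u w" using lame_jet_exists by blast
  note w' = lame_jet_add[OF w jet_kernel_free_jet_last[OF ij]]
  have c: "jcol (free_jet_last i j) j = hv i j" "jcol (free_jet_last i j) i = - hv j i"
    using ij by (simp_all add: jcol_free_jet_last)
  have Z: "free_jet_last i j $ H i j $ j = 1" "free_jet_last i j $ H i j $ i = 0" "free_jet_last i j $ H i j $ k = 0"
     "free_jet_last i j $ H j i $ i = - 1" "free_jet_last i j $ H j i $ j = 0" "free_jet_last i j $ H j i $ k = 0"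
    using d d[symmetric] by (simp_all add: free_jet_last_def H_eq_iff)
  have sum_eq: "(\<Sum>r\<in>UNIV. dd (xi r) (x, u) (jdir w j) * w $ \<alpha> $ r) = dd (xi j) (x, u) (xv j) * w $ \<alpha> $ j"
    if "lame_jet u w" for w j \<alpha>
    unfolding xi_jdir_diag[OF z that] by (simp add: if_distrib[of "\<lambda>a. a * _"] cong: if_cong)
  have "- 2 * dd (xi j) (x, u) (xv j) + 2 * dd (xi i) (x, u) (xv i) = 0"
    using pr_eqs'(5)[OF z w d, unfolded sum_eq[OF w]]
      pr_eqs'(5)[OF z w' d, unfolded sum_eq[OF w'], unfolded jdir_add c dd_components_linear(9,11)[OF z]
        vector_add_component Z phi_hv_diag(1)[OF z ij] phi_hv_diag(1)[OF z ij[symmetric]]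
        phi_diag(1)[OF z ij] phi_diag(1)[OF z ij[symmetric]]]
    by (simp add: algebra_simps)
  then show ?thesis by simp
qed

section \<open>Local constancy of the dilation factor and the ratio\<close>

definition dilation :: "(3, dep) pt \<Rightarrow> real" where "dilation z = dd (xi 1) z (xv 1)"

lemma xi_xv_eq: "(x, u) \<in> N \<Longrightarrow> dd (xi i) (x, u) (xv i) = dilation (x, u)"
  unfolding dilation_def using xi_xv_eq_distinct[of x u i 1] by (cases "i = 1") simp_all

lemma eta_ratio_derivative:
  assumes "z \<in> N"
  shows "eta_ratio k differentiable (at z)" "tang z v \<Longrightarrow> dd (eta_ratio k) z v = 0"
proof -
  obtain x u where zxu: "z = (x, u)" by force
  note z = assms[unfolded zxu]
  have l: "((\<lambda>z. snd z $ L k) has_derivative (\<lambda>v. snd v $ L k)) (at (x, u))"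
    by (intro bounded_linear_imp_has_derivative bounded_linear_compose[OF bounded_linear_vec_nth bounded_linear_snd])
  have e: "(eta k has_derivative dd (eta k) (x, u)) (at (x, u))"
    using differentiable_eta z frechet_derivative_works by blast
  have ne: "snd (x, u) $ L k \<noteq> 0" using nonzero_L[OF z] by simp
  have c: "(eta_ratio k has_derivative (\<lambda>v. (dd (eta k) (x, u) v * u $ L k - eta k (x, u) * snd v $ L k) / (u $ L k * u $ L k))) (at (x, u))"
    using has_derivative_divide'[OF e l ne] unfolding eta_ratio_def[abs_def] snd_conv .
  show "eta_ratio k differentiable (at z)" using c unfolding zxu by (rule differentiableI)
  assume t: "tang z v"
  \<comment> \<open>The numerator of the quotient rule vanishes.\<close>
  have "dd (eta k) (x, u) v * u $ L k = eta k (x, u) * snd v $ L k"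
    using nonzero_L[OF z, of k] by (simp add: eta_deriv[OF z t[unfolded zxu]] eta_ratio_def)
  then show "dd (eta_ratio k) z v = 0" unfolding zxu frechet_derivative_at[OF c, symmetric] by simp
qed

lemma eta_ratio_locally_const:
  assumes "z0 \<in> N"
  shows "\<exists>r>0. \<forall>z\<in>N. dist z0 z < r \<longrightarrow> eta_ratio k z0 = eta_ratio k z"
proof -
  obtain r where "r > 0" and r: "\<forall>(f::(3, dep) pt \<Rightarrow> real) z z'. (\<forall>y\<in>N. f differentiable (at y)) \<longrightarrow>
     z \<in> N \<longrightarrow> z' \<in> N \<longrightarrow> dist z0 z < r \<longrightarrow> dist z0 z' < r \<longrightarrow>
     (\<forall>y\<in>N. \<forall>v. tang y v \<longrightarrow> fst v = fst z' - fst z \<longrightarrow> dd f y v = 0) \<longrightarrow> f z = f z'"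
    using path_const[OF assms] by blast
  have "eta_ratio k z0 = eta_ratio k z" if "z \<in> N" "dist z0 z < r" for z
    using r[rule_format, of "eta_ratio k" z0 z] eta_ratio_derivative assms that \<open>r > 0\<close> by simp
  then show ?thesis using \<open>r > 0\<close> by blast
qed

text \<open>Locally \<open>xi i\<close> is a function of \<open>x_i\<close> alone, hence so is its
  derivative \<open>dilation\<close>, and this for every \<open>i\<close>. A function that depends
  on \<open>x_1\<close> alone and also on \<open>x_2\<close> alone is constant.\<close>

lemma dilation_locally_const:
  assumes z0: "z0 \<in> N"
  shows "\<exists>r>0. \<forall>z\<in>N. dist z0 z < r \<longrightarrow> dilation z0 = dilation z \<and> xi i z - dilation z0 * fst z $ i = xi i z0 - dilation z0 * fst z0 $ i"
proof -
  obtain r1 where "r1 > 0" and r1: "\<forall>(f::(3, dep) pt \<Rightarrow> real) z z'. (\<forall>y\<in>N. f differentiable (at y)) \<longrightarrow>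
     z \<in> N \<longrightarrow> z' \<in> N \<longrightarrow> dist z0 z < r1 \<longrightarrow> dist z0 z' < r1 \<longrightarrow>
     (\<forall>y\<in>N. \<forall>v. tang y v \<longrightarrow> fst v = fst z' - fst z \<longrightarrow> dd f y v = 0) \<longrightarrow> f z = f z'"
    using path_const[OF z0] by blast
  obtain r2 where "r2 > 0" and r2: "ball z0 r2 \<subseteq> M" using open_M z0 open_contains_ball by blast
  define r where "r = min r1 r2"
  have r: "r > 0" "r \<le> r1" "r \<le> r2" using \<open>r1 > 0\<close> \<open>r2 > 0\<close> by (auto simp: r_def)
  \<comment> \<open>Both points are moved along \<open>x_i\<close> by the same amount. Their
    difference keeps a zero \<open>x_i\<close> component, so \<open>path_const\<close> equates
    \<open>xi i\<close> on the two lines, and differentiation at 0 gives the claim.\<close>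
  have same: "dilation z = dilation z'" if z: "z \<in> N" "z' \<in> N" "dist z0 z < r" "dist z0 z' < r"
    and i: "fst z $ i = fst z' $ i" for z z' i
  proof -
    have near: "\<forall>\<^sub>F t in nhds (0::real). z + t *\<^sub>R xv i \<in> N \<and> dist z0 (z + t *\<^sub>R xv i) < r"
      if "z \<in> N" "dist z0 z < r" for z
    proof -
      have "((\<lambda>t::real. z + t *\<^sub>R xv i) \<longlongrightarrow> z + 0 *\<^sub>R xv i) (nhds 0)"
        by (intro tendsto_intros filterlim_ident)
      then have "\<forall>\<^sub>F t in nhds (0::real). z + t *\<^sub>R xv i \<in> ball z0 r"
        using that by (intro topological_tendstoD) auto
      then show ?thesis
      proof eventually_elim
        case (elim t)
        have "z + t *\<^sub>R xv i \<in> M" using elim r r2 by auto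
        moreover have "z + t *\<^sub>R xv i \<in> lame_cone"
          using \<open>z \<in> N\<close> by (cases z) (simp add: lame_cone_def xv_def)
        ultimately show ?case using elim by simp
      qed
    qed
    have "\<forall>\<^sub>F t in nhds (0::real). xi i (z + t *\<^sub>R xv i) = xi i (z' + t *\<^sub>R xv i) + 0 * t"
      using near[OF z(1,3)] near[OF z(2,4)]
    proof eventually_elim
      case (elim t)
      have "xi i (z + t *\<^sub>R xv i) = xi i (z' + t *\<^sub>R xv i)"
      proof (rule r1[rule_format])
        show "dd (xi i) y v = 0"
          if "y \<in> N" "tang y v" "fst v = fst (z' + t *\<^sub>R xv i) - fst (z + t *\<^sub>R xv i)" for y v
        proof -
          have "fst v $ i = 0" using that(3) i by simp
          then show ?thesis using xi_deriv[of "fst y" "snd y" v i] that by simp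
        qed
      qed (use elim r differentiable_xi in auto)
      then show ?case by simp
    qed
    then have "dd (xi i) z (xv i) = dd (xi i) z' (xv i) + 0"
      by (rule dd_line[rotated 2]) (use z differentiable_xi in auto)
    then show ?thesis using xi_xv_eq[of "fst z" "snd z" i] xi_xv_eq[of "fst z'" "snd z'" i] z by simp
  qed
  have dilation: "dilation z0 = dilation z" if z: "z \<in> N" "dist z0 z < r" for z
  proof -
    \<comment> \<open>An intermediate point that shares \<open>x_1\<close> with \<open>z0\<close>
      and \<open>x_2\<close> with \<open>z\<close>, no farther from \<open>z0\<close> than
      \<open>z\<close> is.\<close>
    define z' where "z' = z0 + (fst z $ 2 - fst z0 $ 2) *\<^sub>R xv 2"
    have "dist z0 z' = \<bar>(fst z - fst z0) $ 2\<bar>"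
      by (simp add: z'_def dist_norm xv_def norm_Pair)
    also have "\<dots> \<le> norm (fst (z - z0))" using component_le_norm_cart[of "fst z - fst z0" 2] by simp
    also have "\<dots> \<le> dist z0 z"
      using norm_fst_le[of "fst (z - z0)" "snd (z - z0)"] by (simp add: dist_norm norm_minus_commute del: fst_diff snd_diff)
    finally have d: "dist z0 z' < r" using z by simp
    then have "z' \<in> M" using r r2 by auto
    moreover have "z' \<in> lame_cone" using z0 by (cases z0) (simp add: lame_cone_def z'_def xv_def)
    ultimately have N: "z' \<in> N" by simp
    have "fst z0 $ 1 = fst z' $ 1" "fst z' $ 2 = fst z $ 2"
      by (simp_all add: z'_def vec_simps axis_def)
    then show ?thesis using same[OF z0 N _ d] same[OF N z(1) d z(2)] r(1) by simp
  qed
  \<comment> \<open>Shrinking \<open>M\<close> makes \<open>dilation = dilation z0\<close> available on all of the manifold,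
    as \<open>path_const\<close> requires.\<close>
  interpret near: lame_symmetry "M \<inter> ball z0 r" V
    using open_M nonzero_M differentiable_V symmetry
    by unfold_locales (auto simp: infinitesimal_symmetry_def)
  obtain q where "q > 0" and q: "\<forall>(f::(3, dep) pt \<Rightarrow> real) z z'. (\<forall>y\<in>near.N. f differentiable (at y)) \<longrightarrow>
     z \<in> near.N \<longrightarrow> z' \<in> near.N \<longrightarrow> dist z0 z < q \<longrightarrow> dist z0 z' < q \<longrightarrow>
     (\<forall>y\<in>near.N. \<forall>v. tang y v \<longrightarrow> fst v = fst z' - fst z \<longrightarrow> dd f y v = 0) \<longrightarrow> f z = f z'"
    using near.path_const[of z0] z0 r(1) by auto
  have "xi i z - dilation z0 * fst z $ i = xi i z0 - dilation z0 * fst z0 $ i" if z: "z \<in> N" "dist z0 z < min q r" for z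
  proof -
    \<comment> \<open>Subtracting the linear part with the constant factor
      \<open>dilation z0\<close> leaves a function that is stationary along the cone near
      \<open>z0\<close>.\<close>
    define f where "f y = xi i y - dilation z0 * fst y $ i" for y
    have d: "(f has_derivative (\<lambda>v. dd (xi i) y v - dilation z0 * fst v $ i)) (at y)" if "y \<in> N" for y
    proof -
      have "(xi i has_derivative dd (xi i) y) (at y)"
        using differentiable_xi that frechet_derivative_works by blast
      moreover have "((\<lambda>z. fst z $ i) has_derivative (\<lambda>v. fst v $ i)) (at y)"
        by (intro bounded_linear_imp_has_derivative bounded_linear_compose[OF bounded_linear_vec_nth bounded_linear_fst])
      ultimately show ?thesis unfolding f_def[abs_def]
        by (intro has_derivative_diff has_derivative_mult_right)
    qed
    have "f z = f z0"
    proof (rule q[rule_format])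
      show "f differentiable (at y)" if "y \<in> near.N" for y using d[of y] that by (auto intro: differentiableI)
      show "dd f y v = 0" if y: "y \<in> near.N" "tang y v" for y v
      proof -
        have yN: "(fst y, snd y) \<in> N" "dist z0 y < r" using y by auto
        have "dd f y v = dd (xi i) y v - dilation z0 * fst v $ i"
          using fun_cong[OF frechet_derivative_at[OF d[of y]], of v] y(1) by simp
        also have "dd (xi i) y v = dilation y * fst v $ i"
          using xi_deriv[OF yN(1), of v i] xi_xv_eq[OF yN(1), of i] y by simp
        also have "dilation y = dilation z0" using dilation[of y] yN by simp
        finally show ?thesis by simp
      qed
    qed (use z z0 r \<open>q > 0\<close> in auto)
    then show ?thesis by (simp add: f_def)
  qed
  moreover have "min q r > 0" using \<open>q > 0\<close> r(1) by simp
  ultimately show ?thesis using dilation by (intro exI[of _ "min q r"]) auto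
qed

section \<open>From local constants to a connected component\<close>

lemma const_on_component:
  assumes C: "C \<in> components N" and z: "y \<in> C" "z \<in> C"
    and loc: "\<And>z0. z0 \<in> N \<Longrightarrow> \<exists>r>0. \<forall>z\<in>N. dist z0 z < r \<longrightarrow> f z0 = f z"
  shows "f y = f z"
proof (rule connected_local_const[OF in_components_connected[OF C] z])
  have "\<forall>\<^sub>F b in at a within C. f a = f b" if "a \<in> C" for a
  proof -
    have "C \<subseteq> N" using C by (rule in_components_subset)
    then obtain r where "r > 0" "\<forall>z\<in>N. dist a z < r \<longrightarrow> f a = f z" using loc[of a] \<open>a \<in> C\<close> by auto
    then show ?thesis using \<open>C \<subseteq> N\<close> unfolding eventually_at by (metis dist_commute subsetD)
  qed
  then show "\<forall>a\<in>C. \<forall>\<^sub>F b in at a within C. f a = f b" by blast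
qed

lemma generator_on_component:
  assumes C: "C \<in> components N"
  shows "\<exists>(a::real) (c::real) (b::real^3). \<forall>(x, u) \<in> C. \<forall>i.
           xi i (x, u) = a * x $ i + b $ i \<and> eta i (x, u) = c * u $ L i \<and>
           (\<forall>j. j \<noteq> i \<longrightarrow> phi i j (x, u) = - a * u $ H i j)"
proof -
  obtain z0 where z0: "z0 \<in> C" using in_components_nonempty[OF C] by blast
  have CN: "C \<subseteq> N" using C by (rule in_components_subset)
  have dilation: "dilation z = dilation z0" if "z \<in> C" for z
    using const_on_component[OF C that z0, of dilation] dilation_locally_const by blast
  have eta_ratio: "eta_ratio 1 z = eta_ratio 1 z0" if "z \<in> C" for z
    using const_on_component[OF C that z0, of "eta_ratio 1"] eta_ratio_locally_const by blast
  \<comment> \<open>The value of \<open>g i\<close> at \<open>z0\<close> becomes the translation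
    constant of \<open>xi i\<close>.\<close>
  define g where "g i z = xi i z - dilation z * fst z $ i" for i z
  have g: "g i z = g i z0" if "z \<in> C" for i z
  proof (rule const_on_component[OF C that z0])
    fix y assume "y \<in> N"
    from dilation_locally_const[OF this, of i] show "\<exists>r>0. \<forall>z\<in>N. dist y z < r \<longrightarrow> g i y = g i z"
      unfolding g_def by metis
  qed
  have "xi i (x, u) = dilation z0 * x $ i + (\<chi> i. g i z0) $ i \<and> eta i (x, u) = eta_ratio 1 z0 * u $ L i \<and>
           (\<forall>j. j \<noteq> i \<longrightarrow> phi i j (x, u) = - dilation z0 * u $ H i j)" if xu: "(x, u) \<in> C" for x u i
  proof (intro conjI allI impI)
    have N: "(x, u) \<in> N" using xu CN by blast
    show "xi i (x, u) = dilation z0 * x $ i + (\<chi> i. g i z0) $ i"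
      using g[OF xu, of i] dilation[OF xu] by (simp add: g_def)
    show "eta i (x, u) = eta_ratio 1 z0 * u $ L i"
    proof -
      have "eta i (x, u) = eta_ratio i (x, u) * u $ L i" using nonzero_L[OF N, of i] by (simp add: eta_ratio_def)
      then show ?thesis unfolding eta_ratio_eq[OF N, of i 1] eta_ratio[OF xu] .
    qed
    show "phi i j (x, u) = - dilation z0 * u $ H i j" if "j \<noteq> i" for j
      using phi_diag(2)[OF N that[symmetric]] xi_xv_eq[OF N, of j] dilation[OF xu] by simp
  qed
  then show ?thesis by blast
qed

end

theorem theorem2:
  fixes M C :: "(3, dep) pt set" and V :: "(3, dep) pt \<Rightarrow> (3, dep) pt"
  assumes "open M"
    and "\<And>x u i. (x, u) \<in> M \<Longrightarrow> u $ L i \<noteq> 0"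
    and "smooth_on M V"
    and "infinitesimal_symmetry lame_system M V"
    and "C \<in> components (M \<inter> lame_cone)"
  shows "\<exists>(a::real) (c::real) (b::real^3). \<forall>(x, u) \<in> C. \<forall>i.
           fst (V (x, u)) $ i = a * x $ i + b $ i \<and>
           snd (V (x, u)) $ L i = c * u $ L i \<and>
           (\<forall>j. j \<noteq> i \<longrightarrow> snd (V (x, u)) $ H i j = - a * u $ H i j)"
proof -
  \<comment> \<open>Order one of smoothness supplies the differentiability that the locale asks
    for.\<close>
  have "Ck_on (Suc 0) M V" using assms(3) unfolding smooth_on_def by blast
  then have "V differentiable (at z)" if "z \<in> M" for z using that by simp
  then interpret lame_symmetry M V by unfold_locales (use assms(1,2,4) in blast)+
  show ?thesis using generator_on_component[OF assms(5)] unfolding xi_def eta_def phi_def .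
qed

end
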